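(* The group $\mathcal{G}_{81}$ contains precisely $130$ subgroups isomorphic to $Z_3\times Z_3$. Under conjugation by $\mathcal{G}(\mathcal{L}_4)$ these fall into seven conjugacy classes $\mathcal{K}_1,\dots,\mathcal{K}_7$ of respective sizes $6,24,16,12,16,48,8$.
   Context: Work over $\mathbb{F}_2$. $V_8=V(8,2)=V_a\oplus V_b\oplus V_c\oplus V_d$ with each $V_h$ two-dimensional; $\mathcal{G}(\mathcal{L}_4)\le\operatorname{GL}(8,2)$ is the stabilizer of the set $\{V_a,V_b,V_c,V_d\}$, equal to $(\operatorname{GL}(V_a)\times\dots\times\operatorname{GL}(V_d))\rtimes\operatorname{Sym}(4)$. For $h\in\{a,b,c,d\}$ let $Z_h\cong Z_3$ be the subgroup of $\mathcal{G}(\mathcal{L}_4)$ fixing pointwise each $V_k$, $k\neq h$. $\mathcal{G}_{81}=Z_a\times Z_b\times Z_c\times Z_d\cong(Z_3)^4$, a normal subgroup of $\mathcal{G}(\mathcal{L}_4)$. *)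

theory Defs
  imports
    Complex_Main
    "HOL-Library.Z2"
    "HOL-Algebra.Elementary_Groups"
    "HOL-Algebra.Group_Action"
begin

datatype part = a | b | c | d
hide_const (open) a b c d

definition GL :: "('k::field \<Rightarrow> 'v::ab_group_add \<Rightarrow> 'v) \<Rightarrow> ('v \<Rightarrow> 'v) monoid" where
  "GL scale = \<lparr>carrier = {f. Vector_Spaces.linear scale scale f \<and> bij f},
               monoid.mult = (\<circ>), one = id\<rparr>"

definition direct_sum_decomposition ::
    "('k::field \<Rightarrow> 'v::ab_group_add \<Rightarrow> 'v) \<Rightarrow> (part \<Rightarrow> 'v set) \<Rightarrow> bool" where
  "direct_sum_decomposition scale V \<longleftrightarrow>
     (\<forall>h. module.subspace scale (V h)) \<and>
     (\<forall>v. \<exists>!u. (\<forall>h. u h \<in> V h) \<and> v = u part.a + u part.b + u part.c + u part.d)"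

text \<open>The stabilizer of the set of the four subspaces, i.e. its elements may permute them.\<close>

definition G_L4 :: "('k::field \<Rightarrow> 'v::ab_group_add \<Rightarrow> 'v) \<Rightarrow> (part \<Rightarrow> 'v set) \<Rightarrow> ('v \<Rightarrow> 'v) monoid" where
  "G_L4 scale V =
     (GL scale)\<lparr>carrier := stabilizer (GL scale) (\<lambda>g \<L>. (\<lambda>W. g ` W) ` \<L>) (range V)\<rparr>"

text \<open>Over the two-element field, with two-dimensional summands, the full pointwise stabilizer of the three summands other than the \<open>h\<close>-th one is a copy of
  GL(2,2), of order 6; being isomorphic to the cyclic group of order 3 singles out its unique
  subgroup of order 3.\<close>

definition is_Z :: "('k::field \<Rightarrow> 'v::ab_group_add \<Rightarrow> 'v) \<Rightarrow> (part \<Rightarrow> 'v set) \<Rightarrow> part \<Rightarrow> ('v \<Rightarrow> 'v) set \<Rightarrow> bool" where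
  "is_Z scale V h H \<longleftrightarrow>
     subgroup H (G_L4 scale V) \<and>
     (G_L4 scale V)\<lparr>carrier := H\<rparr> \<cong> integer_mod_group 3 \<and>
     (\<forall>g\<in>H. \<forall>k. k \<noteq> h \<longrightarrow> (\<forall>v\<in>V k. g v = v))"

definition G81 ::
    "('k::field \<Rightarrow> 'v::ab_group_add \<Rightarrow> 'v) \<Rightarrow> (part \<Rightarrow> 'v set) \<Rightarrow> (part \<Rightarrow> ('v \<Rightarrow> 'v) set) \<Rightarrow> ('v \<Rightarrow> 'v) monoid" where
  "G81 scale V Z = (let G = G_L4 scale V in
     G\<lparr>carrier := Z part.a <#>\<^bsub>G\<^esub> Z part.b <#>\<^bsub>G\<^esub> Z part.c <#>\<^bsub>G\<^esub> Z part.d\<rparr>)"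

definition subgroups_Z3_Z3 :: "('g, 'x) monoid_scheme \<Rightarrow> 'g set set" where
  "subgroups_Z3_Z3 G =
     {H. subgroup H G \<and> G\<lparr>carrier := H\<rparr> \<cong> integer_mod_group 3 \<times>\<times> integer_mod_group 3}"

definition conj_set :: "('g, 'x) monoid_scheme \<Rightarrow> 'g \<Rightarrow> 'g set \<Rightarrow> 'g set" where
  "conj_set G g H = g <#\<^bsub>G\<^esub> H #>\<^bsub>G\<^esub> (inv\<^bsub>G\<^esub> g)"

end

theory Submission
  imports Defs
begin

text \<open>Choosing generators \<open>\<zeta>\<^sub>h\<close> of the groups \<open>Z\<^sub>h\<close> identifies the group of order 81 with \<open>F\<^sub>3\<^sup>4\<close>, and
  its subgroups isomorphic to \<open>Z\<^sub>3 \<times> Z\<^sub>3\<close> with the two-dimensional subspaces. Each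
  \<open>V\<^sub>h\<close> is a line over \<open>F\<^sub>4\<close> on which \<open>\<zeta>\<^sub>h\<close> is multiplication by a primitive element, so
  \<open>GL(V\<^sub>h)\<close> consists of semilinear maps, which centralise or invert \<open>\<zeta>\<^sub>h\<close>. Hence conjugation
  by the stabilizer induces on \<open>F\<^sub>3\<^sup>4\<close> exactly the group of monomial (signed permutation)
  transformations. Planes are classified by their Pluecker coordinates, i.e. by
  the points of the Klein quadric over \<open>F\<^sub>3\<close>, and the seven orbits are found by enumeration.\<close>

lemma UNIV_part: "(UNIV :: part set) = {part.a, part.b, part.c, part.d}"
  using part.exhaust by blast

instance part :: finite
  by standard (simp add: UNIV_part)

lemma all_part: "(\<forall>h. P h) \<longleftrightarrow> P part.a \<and> P part.b \<and> P part.c \<and> P part.d"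
  by (metis part.exhaust)

subsection \<open>The field with three elements\<close>

text \<open>Three explicit constructors make case distinction decide identities and let the
  enumeration of orbits be evaluated by rewriting.\<close>

datatype f3 = Z0 | Z1 | Z2

instantiation f3 :: comm_ring_1
begin

definition "zero_f3 = Z0"

definition "one_f3 = Z1"

fun plus_f3 where
  "plus_f3 Z0 y = y"
| "plus_f3 x Z0 = x"
| "plus_f3 Z1 Z1 = Z2"
| "plus_f3 Z1 Z2 = Z0"
| "plus_f3 Z2 Z1 = Z0"
| "plus_f3 Z2 Z2 = Z1"

fun uminus_f3 where
  "uminus_f3 Z0 = Z0"
| "uminus_f3 Z1 = Z2"
| "uminus_f3 Z2 = Z1"

definition "minus_f3 x y = x + - (y :: f3)"

fun times_f3 where
  "times_f3 Z0 y = Z0"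
| "times_f3 Z1 y = y"
| "times_f3 Z2 y = - y"

instance
proof
  fix x y z :: f3
  show "x * y * z = x * (y * z)" by (cases x; cases y; cases z) simp_all
  show "x * y = y * x" by (cases x; cases y) simp_all
  show "1 * x = x" by (simp add: one_f3_def)
  show "x + y + z = x + (y + z)" by (cases x; cases y; cases z) simp_all
  show "x + y = y + x" by (cases x; cases y) simp_all
  show "0 + x = x" by (simp add: zero_f3_def)
  show "- x + x = 0" by (cases x) (simp_all add: zero_f3_def)
  show "x - y = x + - y" by (simp add: minus_f3_def)
  show "(x + y) * z = x * z + y * z" by (cases x; cases y; cases z) simp_all
  show "(0::f3) \<noteq> 1" by (simp add: zero_f3_def one_f3_def)
qed

end

instance f3 :: idom
proof
  fix x y :: f3
  show "x \<noteq> 0 \<Longrightarrow> y \<noteq> 0 \<Longrightarrow> x * y \<noteq> 0"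
    by (cases x; cases y) (simp_all add: zero_f3_def)
qed

lemma UNIV_f3: "(UNIV :: f3 set) = {Z0, Z1, Z2}"
  using f3.exhaust by blast

instance f3 :: finite
  by standard (simp add: UNIV_f3)

text \<open>The nonzero scalars are 1 and -1, so each is its own inverse; multiplication replaces
  division from here on.\<close>

lemma f3_square [simp]: "x \<noteq> 0 \<Longrightarrow> x * x = 1" for x :: f3
  by (cases x) (simp_all add: zero_f3_def one_f3_def)

lemma f3_square_cancel [simp]: "x \<noteq> 0 \<Longrightarrow> x * (x * y) = y" for x y :: f3
  by (metis f3_square mult.assoc mult_1)

lemma f3_add_self [simp]: "x + x = - x" for x :: f3
  by (cases x) simp_all

subsection \<open>Planes and their Pluecker coordinates\<close>

type_synonym vec = "part \<Rightarrow> f3"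

definition comb :: "f3 \<Rightarrow> f3 \<Rightarrow> vec \<Rightarrow> vec \<Rightarrow> vec" where
  "comb i j u v = (\<lambda>h. i * u h + j * v h)"

definition plane :: "vec \<Rightarrow> vec \<Rightarrow> vec set" where
  "plane u v = {comb i j u v | i j. True}"

definition minor :: "vec \<Rightarrow> vec \<Rightarrow> part \<Rightarrow> part \<Rightarrow> f3" where
  "minor u v h k = u h * v k - u k * v h"

definition indep :: "vec \<Rightarrow> vec \<Rightarrow> bool" where
  "indep u v \<longleftrightarrow> (\<exists>h k. minor u v h k \<noteq> 0)"

lemma minor_comb:
  "minor (comb i j u v) (comb k l u v) h m = (i * l - j * k) * minor u v h m"
  by (simp add: minor_def comb_def algebra_simps)

lemma generators_in_plane: "u \<in> plane u v" "v \<in> plane u v"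
proof -
  have "u = comb 1 0 u v" "v = comb 0 1 u v" by (simp_all add: comb_def)
  then show "u \<in> plane u v" "v \<in> plane u v" unfolding plane_def by blast+
qed

text \<open>Cramer's rule: eliminating one unknown from two coordinates of the equation leaves the
  other one times a nonzero minor.\<close>

lemma comb_eq_iff:
  assumes "indep u v"
  shows "comb i j u v = comb k l u v \<longleftrightarrow> i = k \<and> j = l"
proof
  assume eq: "comb i j u v = comb k l u v"
  obtain m n where mn: "minor u v m n \<noteq> 0" using assms by (auto simp: indep_def)
  have e: "(i - k) * u h + (j - l) * v h = 0" for h
    using fun_cong[OF eq, of h] by (simp add: comb_def algebra_simps)
  have "(i - k) * minor u v m n
      = ((i - k) * u m + (j - l) * v m) * v n - ((i - k) * u n + (j - l) * v n) * v m"
    by (simp add: minor_def algebra_simps)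
  moreover have "(j - l) * minor u v m n
      = ((i - k) * u n + (j - l) * v n) * u m - ((i - k) * u m + (j - l) * v m) * u n"
    by (simp add: minor_def algebra_simps)
  ultimately have "(i - k) * minor u v m n = 0" "(j - l) * minor u v m n = 0"
    by (simp_all only: e mult_zero_left diff_self)
  then show "i = k \<and> j = l" using mn by simp
qed simp

lemma card_plane:
  assumes "indep u v"
  shows "card (plane u v) = 9"
proof -
  have "plane u v = (\<lambda>(i, j). comb i j u v) ` UNIV"
    by (auto simp: plane_def)
  moreover have "inj (\<lambda>(i, j). comb i j u v)"
    by (auto simp: inj_on_def comb_eq_iff[OF assms])
  ultimately have "card (plane u v) = card (UNIV :: (f3 \<times> f3) set)"
    by (simp add: card_image)
  also have "\<dots> = 9"
    unfolding UNIV_Times_UNIV[symmetric] card_cartesian_product by (simp add: UNIV_f3)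
  finally show ?thesis .
qed

text \<open>At a coordinate \<open>k\<close> where \<open>u\<close> is nonzero, the vanishing minors
  give the ratio \<open>u k * v k\<close>, since \<open>u k\<close> is its own inverse.\<close>

lemma dependentD:
  assumes "\<not> indep u v" and "u \<noteq> (\<lambda>h. 0)"
  shows "\<exists>j. v = (\<lambda>h. j * u h)"
proof -
  obtain k where k: "u k \<noteq> 0" using assms(2) by auto
  have "u k * v h = u h * v k" for h
    using assms(1) by (auto simp: indep_def minor_def)
  then have "u k * (u k * v h) = u k * (u h * v k)" for h by simp
  then have "v h = (u k * v k) * u h" for h
    unfolding f3_square_cancel[OF k] by (metis mult.assoc mult.commute)
  then have "v = (\<lambda>h. (u k * v k) * u h)" by blast
  then show ?thesis by blast
qed

text \<open>The right-hand side is the vanishing of the wedge product of \<open>x\<close>, \<open>u\<close> and \<open>v\<close>.\<close>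

lemma in_plane_iff:
  assumes "indep u v"
  shows "x \<in> plane u v \<longleftrightarrow>
    (\<forall>h k l. x h * minor u v k l - x k * minor u v h l + x l * minor u v h k = 0)"
proof
  assume "x \<in> plane u v"
  then show "\<forall>h k l. x h * minor u v k l - x k * minor u v h l + x l * minor u v h k = 0"
    by (auto simp: plane_def comb_def minor_def algebra_simps)
next
  assume eq: "\<forall>h k l. x h * minor u v k l - x k * minor u v h l + x l * minor u v h k = 0"
  obtain k l where kl: "minor u v k l \<noteq> 0" using assms by (auto simp: indep_def)
  \<comment> \<open>Cramer's solution on the coordinates \<open>k\<close> and \<open>l\<close>;
    multiplying by the minor amounts to dividing by it.\<close>
  define i j where "i = minor u v k l * (x k * v l - x l * v k)"
    and "j = minor u v k l * (x l * u k - x k * u l)"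
  have "x h = comb i j u v h" for h
  proof -
    have "minor u v k l * x h = x k * minor u v h l - x l * minor u v h k"
      using eq[rule_format, of h k l] by (simp add: algebra_simps)
    then have "minor u v k l * (minor u v k l * x h)
        = minor u v k l * (x k * minor u v h l - x l * minor u v h k)"
      by simp
    then have "x h = minor u v k l * (x k * minor u v h l - x l * minor u v h k)"
      using kl by simp
    also have "\<dots> = comb i j u v h"
      unfolding i_def j_def comb_def minor_def[of u v h] by (simp add: algebra_simps)
    finally show ?thesis .
  qed
  then show "x \<in> plane u v" by (auto simp: plane_def)
qed

section \<open>Projective points as normalised coordinate lists\<close>

fun lead :: "f3 list \<Rightarrow> f3" where
  "lead [] = 0"
| "lead (x # xs) = (if x = 0 then lead xs else x)"

text \<open>Multiplying by the leading entry divides by it, so the first nonzero entry becomes 1.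
  Proportional lists thus get one common representative, and projective points can be compared by
  equality of lists.\<close>

definition normalise :: "f3 list \<Rightarrow> f3 list" where
  "normalise xs = map ((*) (lead xs)) xs"

lemma lead_scale: "lead (map ((*) c) xs) = c * lead xs"
  by (induction xs) auto

lemma lead_eq_0: "lead xs = 0 \<Longrightarrow> x \<in> set xs \<Longrightarrow> x = 0"
  by (induction xs) (auto split: if_splits)

lemma normalise_scale: "c \<noteq> 0 \<Longrightarrow> normalise (map ((*) c) xs) = normalise xs"
  by (simp add: normalise_def lead_scale ac_simps)

lemma normalise_eq_scale: "\<exists>c. c \<noteq> 0 \<and> normalise xs = map ((*) c) xs"
proof (cases "lead xs = 0")
  case True
  \<comment> \<open>For a zero list \<open>lead\<close> is 0; the factor 1 has the same effect and
    is nonzero.\<close>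
  then have "normalise xs = map ((*) 1) xs"
    by (auto simp: normalise_def dest: lead_eq_0)
  then show ?thesis by (metis zero_neq_one)
qed (auto simp: normalise_def)

lemma normalise_idem: "normalise (normalise xs) = normalise xs"
  by (metis normalise_eq_scale normalise_scale)

lemma normalise_eqD:
  assumes "normalise xs = normalise ys"
  shows "\<exists>c. c \<noteq> 0 \<and> ys = map ((*) c) xs"
proof -
  obtain c d where c: "c \<noteq> 0" "normalise xs = map ((*) c) xs"
    and d: "d \<noteq> 0" "normalise ys = map ((*) d) ys"
    using normalise_eq_scale by metis
  \<comment> \<open>A second multiplication by \<open>d\<close> undoes the first.\<close>
  have "map ((*) d) (map ((*) d) ys) = map ((*) d) (map ((*) c) xs)"
    using assms c d by simp
  then have "ys = map ((*) (d * c)) xs"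
    using d(1) by (simp add: o_def mult.assoc)
  then show ?thesis using c(1) d(1) by (metis mult_eq_0_iff)
qed

type_synonym quadruple = "f3 \<times> f3 \<times> f3 \<times> f3"

text \<open>The six Pluecker coordinates, index pairs in lexicographic order. Tuples and lists
  instead of functions keep them computable.\<close>

fun minors :: "quadruple \<Rightarrow> quadruple \<Rightarrow> f3 list" where
  "minors (u1, u2, u3, u4) (v1, v2, v3, v4) =
    [u1 * v2 - u2 * v1, u1 * v3 - u3 * v1, u1 * v4 - u4 * v1,
     u2 * v3 - u3 * v2, u2 * v4 - u4 * v2, u3 * v4 - u4 * v3]"

definition coords :: "vec \<Rightarrow> quadruple" where
  "coords x = (x part.a, x part.b, x part.c, x part.d)"

definition key :: "vec \<Rightarrow> vec \<Rightarrow> f3 list" where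
  "key u v = normalise (minors (coords u) (coords v))"

text \<open>Minors are alternating in their indices, so the six listed ones determine all
  sixteen.\<close>

lemma minors_scale_iff:
  "minors (coords u') (coords v') = map ((*) c) (minors (coords u) (coords v)) \<longleftrightarrow>
    (\<forall>h k. minor u' v' h k = c * minor u v h k)"
proof -
  have flip: "minor u v h k = - minor u v k h" for u v h k by (simp add: minor_def)
  have diag: "minor u v h h = 0" for u v h by (simp add: minor_def)
  have m: "minors (coords u) (coords v) =
      [minor u v part.a part.b, minor u v part.a part.c, minor u v part.a part.d,
       minor u v part.b part.c, minor u v part.b part.d, minor u v part.c part.d]" for u v
    by (simp add: coords_def minor_def)
  show ?thesis
    unfolding m all_part diag flip[of _ _ part.b part.a] flip[of _ _ part.c part.a]
      flip[of _ _ part.d part.a] flip[of _ _ part.c part.b] flip[of _ _ part.d part.b]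
      flip[of _ _ part.d part.c]
    by auto
qed

lemma indep_iff_minors: "indep u v \<longleftrightarrow> minors (coords u) (coords v) \<noteq> [0, 0, 0, 0, 0, 0]"
proof -
  have "indep u v \<longleftrightarrow> minors (coords u) (coords v) \<noteq> map ((*) 0) (minors (coords u) (coords v))"
    unfolding minors_scale_iff indep_def by simp
  then show ?thesis by (simp add: coords_def)
qed

text \<open>A change of basis multiplies all minors by its determinant, so the key depends on the
  plane alone. Conversely the minors are the coefficients of linear equations that cut out the
  plane, and a common factor does not change the solutions.\<close>

lemma plane_eq_iff_key:
  assumes "indep u v" and "indep u' v'"
  shows "plane u v = plane u' v' \<longleftrightarrow> key u v = key u' v'"
proof
  assume "plane u v = plane u' v'"
  then have "u' \<in> plane u v" "v' \<in> plane u v" using generators_in_plane by auto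
  then obtain i j k l where uv: "u' = comb i j u v" "v' = comb k l u v"
    by (auto simp: plane_def)
  then have m: "minor u' v' h n = (i * l - j * k) * minor u v h n" for h n
    by (simp add: minor_comb)
  then have "i * l - j * k \<noteq> 0" using assms(2) by (auto simp: indep_def)
  moreover have "minors (coords u') (coords v')
      = map ((*) (i * l - j * k)) (minors (coords u) (coords v))"
    by (simp add: minors_scale_iff m)
  ultimately show "key u v = key u' v'" by (simp add: key_def normalise_scale)
next
  assume "key u v = key u' v'"
  then obtain c where c: "c \<noteq> 0"
    "minors (coords u') (coords v') = map ((*) c) (minors (coords u) (coords v))"
    unfolding key_def using normalise_eqD by blast
  then have m: "minor u' v' h k = c * minor u v h k" for h k
    by (simp add: minors_scale_iff)
  have "x h * (c * p) - x k * (c * q) + x l * (c * r) = c * (x h * p - x k * q + x l * r)"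
    for x :: vec and h k l p q r by (simp add: algebra_simps)
  then show "plane u v = plane u' v'"
    using c(1) by (auto simp: in_plane_iff assms m)
qed

subsection \<open>Monomial orbits of planes\<close>

text \<open>Coordinates are pulled back along \<open>\<sigma>\<close>: a map that moves place
  \<open>h\<close> to place \<open>\<pi> h\<close> has the inverse of \<open>\<pi>\<close> as its
  \<open>\<sigma>\<close>, and composition reverses the order of the permutations.\<close>

definition monomial :: "(part \<Rightarrow> part) \<Rightarrow> vec \<Rightarrow> vec \<Rightarrow> vec" where
  "monomial \<sigma> s x = (\<lambda>h. s h * x (\<sigma> h))"

definition monomials :: "(vec \<Rightarrow> vec) set" where
  "monomials = {monomial \<sigma> s | \<sigma> s. bij \<sigma> \<and> (\<forall>h. s h \<noteq> 0)}"

lemma monomial_comb: "monomial \<sigma> s (comb i j u v) = comb i j (monomial \<sigma> s u) (monomial \<sigma> s v)"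
  by (simp add: monomial_def comb_def algebra_simps)

lemma monomial_plane: "monomial \<sigma> s ` plane u v = plane (monomial \<sigma> s u) (monomial \<sigma> s v)"
proof -
  have "plane u v = (\<lambda>(i, j). comb i j u v) ` UNIV" for u v
    by (auto simp: plane_def)
  then show ?thesis
    by (simp add: image_comp o_def case_prod_unfold monomial_comb)
qed

lemma minor_monomial:
  "minor (monomial \<sigma> s u) (monomial \<sigma> s v) h k = s h * s k * minor u v (\<sigma> h) (\<sigma> k)"
  by (simp add: minor_def monomial_def algebra_simps)

lemma indep_monomial:
  assumes "bij \<sigma>" "\<And>h. s h \<noteq> 0" "indep u v"
  shows "indep (monomial \<sigma> s u) (monomial \<sigma> s v)"
proof -
  obtain h k where "minor u v h k \<noteq> 0" using assms(3) by (auto simp: indep_def)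
  then have "minor (monomial \<sigma> s u) (monomial \<sigma> s v) (inv_into UNIV \<sigma> h) (inv_into UNIV \<sigma> k) \<noteq> 0"
    using assms by (simp add: minor_monomial bij_is_surj surj_f_inv_f)
  then show ?thesis by (auto simp: indep_def)
qed

lemma monomials_comp:
  assumes "M \<in> monomials" "N \<in> monomials"
  shows "M \<circ> N \<in> monomials"
proof -
  obtain \<sigma> s \<tau> t where M: "M = monomial \<sigma> s" "bij \<sigma>" "\<forall>h. s h \<noteq> 0"
    and N: "N = monomial \<tau> t" "bij \<tau>" "\<forall>h. t h \<noteq> 0"
    using assms by (auto simp: monomials_def)
  have "M \<circ> N = monomial (\<tau> \<circ> \<sigma>) (\<lambda>h. s h * t (\<sigma> h))"
    unfolding M(1) N(1) monomial_def by (simp add: mult.assoc comp_def)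
  then show ?thesis
    using M N by (auto simp: monomials_def intro!: bij_comp exI)
qed

lemma monomials_inverse:
  assumes "M \<in> monomials"
  shows "\<exists>N\<in>monomials. N \<circ> M = id"
proof -
  obtain \<sigma> s where M: "M = monomial \<sigma> s" "bij \<sigma>" "\<forall>h. s h \<noteq> 0"
    using assms by (auto simp: monomials_def)
  \<comment> \<open>Signs are their own inverses and only have to be moved along with the
    places.\<close>
  let ?N = "monomial (inv_into UNIV \<sigma>) (\<lambda>h. s (inv_into UNIV \<sigma> h))"
  have "?N \<circ> M = id"
    using M by (simp add: monomial_def fun_eq_iff bij_is_surj surj_f_inv_f)
  moreover have "?N \<in> monomials"
    unfolding monomials_def using M by (blast intro: bij_imp_bij_inv)
  ultimately show ?thesis by blast
qed

definition monomial_orbit :: "vec set \<Rightarrow> vec set set" where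
  "monomial_orbit W = {M ` W | M. M \<in> monomials}"

lemma monomial_orbit_subset:
  assumes "W' \<in> monomial_orbit W"
  shows "monomial_orbit W' \<subseteq> monomial_orbit W"
proof
  fix U assume "U \<in> monomial_orbit W'"
  then obtain M N where MN: "M \<in> monomials" "N \<in> monomials" "U = N ` M ` W"
    using assms by (auto simp: monomial_orbit_def)
  then have "U = (N \<circ> M) ` W" by (simp add: image_comp)
  then show "U \<in> monomial_orbit W"
    unfolding monomial_orbit_def using monomials_comp[OF MN(2,1)] by blast
qed

text \<open>Inverses put \<open>W\<close> back into the orbit of \<open>W'\<close>, so the inclusion
  of orbits holds both ways.\<close>

lemma monomial_orbit_eq:
  assumes "W' \<in> monomial_orbit W"
  shows "monomial_orbit W' = monomial_orbit W"
proof -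
  obtain M where M: "M \<in> monomials" "W' = M ` W" using assms by (auto simp: monomial_orbit_def)
  then obtain N where N: "N \<in> monomials" "N \<circ> M = id" using monomials_inverse by blast
  then have "W = N ` W'" using M by (simp add: image_comp)
  then have "W \<in> monomial_orbit W'" using N by (auto simp: monomial_orbit_def)
  then show ?thesis using assms monomial_orbit_subset by blast
qed

section \<open>Enumeration of the orbits of Pluecker points\<close>

definition all_parts :: "part list" where
  "all_parts = [part.a, part.b, part.c, part.d]"

definition orderings :: "(part \<times> part \<times> part \<times> part) list" where
  "orderings = filter (\<lambda>(p, q, r, t). distinct [p, q, r, t])
     (List.product all_parts (List.product all_parts (List.product all_parts all_parts)))"

text \<open>An overall sign acts trivially on planes, so the first sign is normalised to be \<open>1\<close>.\<close>

definition sign_choices :: "quadruple list" where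
  "sign_choices = List.product [Z1] (List.product [Z1, Z2] (List.product [Z1, Z2] [Z1, Z2]))"

fun scale_coords :: "quadruple \<Rightarrow> quadruple \<Rightarrow> quadruple" where
  "scale_coords (s1, s2, s3, s4) (x1, x2, x3, x4) = (s1 * x1, s2 * x2, s3 * x3, s4 * x4)"

text \<open>Runs through 24 permutations and 8 sign patterns. After \<open>remdups\<close> the
  length counts the planes in the orbit, because a plane is determined by its key.\<close>

definition orbit_keys :: "vec \<times> vec \<Rightarrow> f3 list list" where
  "orbit_keys W = remdups (map
     (\<lambda>((p, q, r, t), s).
        normalise (minors (scale_coords s (fst W p, fst W q, fst W r, fst W t))
                          (scale_coords s (snd W p, snd W q, snd W r, snd W t))))
     (List.product orderings sign_choices))"

text \<open>One basis per orbit, in the order of the sizes in the theorem. Of the two orbits of size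
  16, the third entry has a coordinate vector in its plane and the fifth has none; the last plane is
  the tetracode, whose nonzero words all have weight three.\<close>

definition reps :: "(vec \<times> vec) list" where
  "reps =
    [(case_part Z0 Z0 Z1 Z0, case_part Z0 Z0 Z0 Z1),
     (case_part Z0 Z1 Z1 Z0, case_part Z0 Z0 Z0 Z1),
     (case_part Z1 Z1 Z1 Z0, case_part Z0 Z0 Z0 Z1),
     (case_part Z1 Z1 Z0 Z0, case_part Z0 Z0 Z1 Z1),
     (case_part Z0 Z1 Z2 Z0, case_part Z0 Z1 Z0 Z1),
     (case_part Z1 Z1 Z2 Z0, case_part Z0 Z0 Z1 Z1),
     (case_part Z1 Z1 Z1 Z0, case_part Z0 Z1 Z2 Z1)]"

text \<open>The Pluecker relation p12 p34 - p13 p24 + p14 p23 = 0, with the coordinates in the order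
  of \<open>minors\<close>.\<close>

fun klein :: "f3 list \<Rightarrow> bool" where
  "klein [p, q, r, s, t, u] \<longleftrightarrow> p * u - q * t + r * s = 0"
| "klein _ \<longleftrightarrow> False"

definition klein_points :: "f3 list list" where
  "klein_points = filter (\<lambda>p. klein p \<and> normalise p = p \<and> p \<noteq> [0, 0, 0, 0, 0, 0])
     (List.n_lists 6 [Z0, Z1, Z2])"

text \<open>Collects the computed facts in one decidable statement. Its last clause says that the
  lists cover the quadric; that they stay inside it follows from every orbit key being the key of a
  plane.\<close>

definition partitions_klein_points :: "f3 list list list \<Rightarrow> bool" where
  "partitions_klein_points Ls \<longleftrightarrow> map length Ls = [6, 24, 16, 12, 16, 48, 8] \<and>
     distinct (concat Ls) \<and> list_all (\<lambda>p. p \<in> set (concat Ls)) klein_points"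

text \<open>The main finite computation: 192 images of each representative, compared with the points
  of the quadric among all 729 lists.\<close>

lemma orbit_keys_partition: "partitions_klein_points (map orbit_keys reps)"
  by code_simp

lemma reps_indep:
  assumes "W \<in> set reps"
  shows "indep (fst W) (snd W)"
proof -
  have "list_all (\<lambda>W. minors (coords (fst W)) (coords (snd W)) \<noteq> [0, 0, 0, 0, 0, 0]) reps"
    by code_simp
  then show ?thesis using assms unfolding list_all_iff indep_iff_minors by blast
qed

text \<open>The Pluecker relation is a polynomial identity in the entries of \<open>u\<close> and
  \<open>v\<close>; being homogeneous, it survives normalisation.\<close>

lemma key_in_klein_points:
  assumes "indep u v"
  shows "key u v \<in> set klein_points"
proof -
  obtain c where c: "c \<noteq> 0" "key u v = map ((*) c) (minors (coords u) (coords v))"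
    using normalise_eq_scale key_def by metis
  have "klein (key u v)"
    unfolding c(2) by (simp add: coords_def algebra_simps)
  moreover have "normalise (key u v) = key u v"
    by (simp add: key_def normalise_idem)
  moreover have "key u v \<noteq> [0, 0, 0, 0, 0, 0]"
    using assms c by (simp add: indep_iff_minors coords_def)
  moreover have "length (key u v) = 6"
    unfolding c(2) by (simp add: coords_def)
  moreover have "x \<in> set [Z0, Z1, Z2]" for x by (cases x) simp_all
  ultimately show ?thesis unfolding klein_points_def set_filter set_n_lists by blast
qed

lemma set_orderings:
  "set orderings = {(\<sigma> part.a, \<sigma> part.b, \<sigma> part.c, \<sigma> part.d) | \<sigma>. bij \<sigma>}" (is "_ = ?R")
proof -
  have "set all_parts = UNIV" by (simp add: all_parts_def UNIV_part)
  then have "set orderings = {(p, q, r, t). distinct [p, q, r, t]}"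
    unfolding orderings_def set_filter set_product by blast
  also have "\<dots> = ?R"
  proof (intro equalityI subsetI)
    fix x assume "x \<in> {(p, q, r, t). distinct [p, q, r, t :: part]}"
    then obtain p q r t where x: "x = (p, q, r, t)" "distinct [p, q, r, t]" by blast
    have "inj (case_part p q r t)"
      using x(2) by (auto simp: inj_def split: part.splits)
    then have "bij (case_part p q r t)" by (simp add: bij_def finite_UNIV_inj_surj)
    then show "x \<in> ?R" using x(1) by (auto intro!: exI[of _ "case_part p q r t"])
  qed (auto dest!: bij_is_inj simp: inj_eq)
  finally show ?thesis .
qed

lemma set_sign_choices:
  "set sign_choices = {coords s | s. s part.a = 1 \<and> (\<forall>h. s h \<noteq> 0)}" (is "_ = ?R")
proof -
  have nz: "set [Z1, Z2] = {x. x \<noteq> 0}" and one: "set [Z1] = {1}"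
    using f3.exhaust by (auto simp: zero_f3_def one_f3_def)
  have "set sign_choices = {1} \<times> {x. x \<noteq> 0} \<times> {x. x \<noteq> 0} \<times> {x. x \<noteq> 0}"
    unfolding sign_choices_def set_product nz one ..
  also have "\<dots> = ?R"
  proof (intro equalityI subsetI)
    fix x :: quadruple
    assume "x \<in> {1} \<times> {x. x \<noteq> 0} \<times> {x. x \<noteq> 0} \<times> {x. x \<noteq> 0}"
    then obtain p q r where "x = (1, p, q, r)" "p \<noteq> 0" "q \<noteq> 0" "r \<noteq> 0" by blast
    then show "x \<in> ?R"
      by (auto simp: coords_def all_part intro!: exI[of _ "case_part 1 p q r"])
  qed (auto simp: coords_def)
  finally show ?thesis .
qed

text \<open>A common factor \<open>c\<close> multiplies every minor by \<open>c * c\<close>, which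
  normalisation removes. Hence the first sign may be taken to be 1.\<close>

lemma key_monomial_cong:
  assumes "c \<noteq> 0"
  shows "key (monomial \<sigma> (\<lambda>h. c * s h) u) (monomial \<sigma> (\<lambda>h. c * s h) v)
       = key (monomial \<sigma> s u) (monomial \<sigma> s v)"
proof -
  have "minors (coords (monomial \<sigma> (\<lambda>h. c * s h) u)) (coords (monomial \<sigma> (\<lambda>h. c * s h) v))
    = map ((*) (c * c)) (minors (coords (monomial \<sigma> s u)) (coords (monomial \<sigma> s v)))"
    unfolding minors_scale_iff minor_monomial by (simp add: algebra_simps del: f3_square)
  then show ?thesis using assms by (simp add: key_def normalise_scale)
qed

lemma set_orbit_keys:
  "set (orbit_keys (u, v)) = {key (M u) (M v) | M. M \<in> monomials}" (is "_ = ?R")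
proof -
  have sc: "scale_coords (coords s) (x (\<sigma> part.a), x (\<sigma> part.b), x (\<sigma> part.c), x (\<sigma> part.d))
      = coords (monomial \<sigma> s x)" for s \<sigma> x
    by (simp add: coords_def monomial_def)
  have "set (orbit_keys (u, v)) = (\<lambda>((p, q, r, t), s).
        normalise (minors (scale_coords s (u p, u q, u r, u t)) (scale_coords s (v p, v q, v r, v t))))
      ` (set orderings \<times> set sign_choices)"
    unfolding orbit_keys_def set_remdups set_map set_product fst_conv snd_conv ..
  also have "set orderings \<times> set sign_choices =
      (\<lambda>(\<sigma>, s). ((\<sigma> part.a, \<sigma> part.b, \<sigma> part.c, \<sigma> part.d), coords s))
        ` {(\<sigma>, s). bij \<sigma> \<and> s part.a = 1 \<and> (\<forall>h. s h \<noteq> 0)}"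
    unfolding set_orderings set_sign_choices by (auto simp: image_def)
  finally have "set (orbit_keys (u, v)) = {key (monomial \<sigma> s u) (monomial \<sigma> s v) | \<sigma> s.
      bij \<sigma> \<and> s part.a = 1 \<and> (\<forall>h. s h \<noteq> 0)}"
    unfolding image_comp o_def case_prod_unfold fst_conv snd_conv sc key_def[symmetric]
    by (auto simp: image_def)
  also have "\<dots> = ?R"
  proof (intro equalityI subsetI)
    fix x assume "x \<in> ?R"
    then obtain \<sigma> s where x: "x = key (monomial \<sigma> s u) (monomial \<sigma> s v)" "bij \<sigma>" "\<forall>h. s h \<noteq> 0"
      by (auto simp: monomials_def)
    \<comment> \<open>All signs are divided by the first one, which is its own inverse.\<close>
    let ?s = "\<lambda>h. s part.a * s h"
    have "x = key (monomial \<sigma> ?s u) (monomial \<sigma> ?s v)" "?s part.a = 1" "\<forall>h. ?s h \<noteq> 0"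
      using x by (simp_all add: key_monomial_cong)
    then show "x \<in> {key (monomial \<sigma> s u) (monomial \<sigma> s v) | \<sigma> s.
      bij \<sigma> \<and> s part.a = 1 \<and> (\<forall>h. s h \<noteq> 0)}" using x(2) by blast
  qed (auto simp: monomials_def)
  finally show ?thesis .
qed

section \<open>The 130 planes and their seven orbits\<close>

definition planes :: "vec set set" where
  "planes = {plane u v | u v. indep u v}"

text \<open>On \<open>planes\<close> the described value exists and is independent of the basis, by
  \<open>plane_eq_iff_key\<close>.\<close>

definition plane_key :: "vec set \<Rightarrow> f3 list" where
  "plane_key W = (THE k. \<exists>u v. indep u v \<and> W = plane u v \<and> k = key u v)"

lemma plane_key: "indep u v \<Longrightarrow> plane_key (plane u v) = key u v"
  unfolding plane_key_def by (rule the_equality) (auto simp: plane_eq_iff_key)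

lemma inj_on_plane_key: "inj_on plane_key planes"
proof (rule inj_onI)
  fix W W' assume "W \<in> planes" "W' \<in> planes" and eq: "plane_key W = plane_key W'"
  then obtain u v u' v' where "indep u v" "W = plane u v" "indep u' v'" "W' = plane u' v'"
    by (auto simp: planes_def)
  then show "W = W'" using eq plane_key plane_eq_iff_key by metis
qed

lemma image_monomials_plane:
  assumes "M \<in> monomials" "indep u v"
  shows "M ` plane u v = plane (M u) (M v)" "indep (M u) (M v)"
proof -
  obtain \<sigma> s where "M = monomial \<sigma> s" "bij \<sigma>" "\<And>h. s h \<noteq> 0"
    using assms(1) by (auto simp: monomials_def)
  then show "M ` plane u v = plane (M u) (M v)" "indep (M u) (M v)"
    using assms(2) by (simp_all only: monomial_plane indep_monomial not_False_eq_True)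
qed

lemma monomial_orbit_subset_planes:
  assumes "W \<in> planes"
  shows "monomial_orbit W \<subseteq> planes"
proof -
  obtain u v where "indep u v" "W = plane u v" using assms by (auto simp: planes_def)
  then show ?thesis
    unfolding monomial_orbit_def planes_def using image_monomials_plane by blast
qed

lemma plane_key_orbit:
  assumes "indep u v"
  shows "plane_key ` monomial_orbit (plane u v) = set (orbit_keys (u, v))"
proof -
  have "plane_key (M ` plane u v) = key (M u) (M v)" if "M \<in> monomials" for M
    using image_monomials_plane[OF that assms] plane_key by metis
  moreover have "monomial_orbit W = (\<lambda>M. M ` W) ` monomials" for W
    by (auto simp: monomial_orbit_def)
  moreover have "set (orbit_keys (u, v)) = (\<lambda>M. key (M u) (M v)) ` monomials"
    by (auto simp: set_orbit_keys)
  ultimately show ?thesis by (simp add: image_image cong: image_cong)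
qed

definition rep_orbit :: "nat \<Rightarrow> vec set set" where
  "rep_orbit i = monomial_orbit (plane (fst (reps ! i)) (snd (reps ! i)))"

lemma length_reps: "length reps = 7"
  by (simp add: reps_def)

lemma plane_key_rep_orbit: "i < 7 \<Longrightarrow> plane_key ` rep_orbit i = set (orbit_keys (reps ! i))"
  using plane_key_orbit[OF reps_indep] length_reps by (simp add: rep_orbit_def)

lemma rep_in_planes: "i < 7 \<Longrightarrow> plane (fst (reps ! i)) (snd (reps ! i)) \<in> planes"
  using reps_indep[of "reps ! i"] length_reps by (auto simp: planes_def)

lemma card_rep_orbit:
  assumes "i < 7"
  shows "card (rep_orbit i) = [6, 24, 16, 12, 16, 48, 8] ! i"
proof -
  have "rep_orbit i \<subseteq> planes"
    unfolding rep_orbit_def using monomial_orbit_subset_planes rep_in_planes assms by blast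
  then have "card (rep_orbit i) = card (plane_key ` rep_orbit i)"
    by (metis card_image inj_on_plane_key inj_on_subset)
  also have "\<dots> = length (orbit_keys (reps ! i))"
    unfolding plane_key_rep_orbit[OF assms] orbit_keys_def by (simp add: length_remdups_card_conv)
  also have "\<dots> = map length (map orbit_keys reps) ! i"
    using assms length_reps by simp
  finally show ?thesis using orbit_keys_partition by (simp only: partitions_klein_points_def)
qed

text \<open>The key of a plane lies on the quadric, which the lists cover; a listed key belongs to a
  monomial image of a representative, again a plane.\<close>

lemma keys_of_planes: "plane_key ` planes = set (concat (map orbit_keys reps))"
proof (intro equalityI subsetI)
  fix k assume "k \<in> plane_key ` planes"
  then have "k \<in> set klein_points"
    by (auto simp: planes_def plane_key key_in_klein_points)
  then show "k \<in> set (concat (map orbit_keys reps))"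
    using orbit_keys_partition by (simp only: partitions_klein_points_def list_all_iff)
next
  fix k assume "k \<in> set (concat (map orbit_keys reps))"
  then obtain i where i: "i < 7" "k \<in> set (orbit_keys (reps ! i))"
    using length_reps by (auto simp: in_set_conv_nth[of _ reps])
  then have "k \<in> plane_key ` rep_orbit i" by (simp add: plane_key_rep_orbit)
  then show "k \<in> plane_key ` planes"
    unfolding rep_orbit_def using monomial_orbit_subset_planes[OF rep_in_planes[OF i(1)]] by blast
qed

lemma card_planes: "card planes = 130"
proof -
  have "card planes = card (set (concat (map orbit_keys reps)))"
    by (metis card_image inj_on_plane_key keys_of_planes)
  also have "\<dots> = length (concat (map orbit_keys reps))"
    using orbit_keys_partition by (metis distinct_card partitions_klein_points_def)
  also have "\<dots> = sum_list (map length (map orbit_keys reps))"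
    by (simp only: length_concat)
  also have "\<dots> = 130"
    using orbit_keys_partition unfolding partitions_klein_points_def by simp
  finally show ?thesis .
qed

text \<open>Equal orbits would have equal key sets, whereas the lists of keys are disjoint. Every
  plane has its key in some list and therefore lies in the corresponding orbit, keys being
  injective.\<close>

lemma bij_betw_rep_orbit: "bij_betw rep_orbit {..<7} (monomial_orbit ` planes)"
proof (rule bij_betw_imageI)
  show "inj_on rep_orbit {..<7}"
  proof (rule inj_onI)
    fix i j assume ij: "i \<in> {..<7}" "j \<in> {..<7}" "rep_orbit i = rep_orbit j"
    let ?L = "map orbit_keys reps"
    have L: "distinct (concat ?L)" "map length ?L = [6, 24, 16, 12, 16, 48, 8]"
      using orbit_keys_partition by (simp_all only: partitions_klein_points_def)
    \<comment> \<open>\<open>distinct_concat_iff\<close> does not exclude repeated empty lists; here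
      no list is empty, as all lengths are positive.\<close>
    have "0 \<notin> set (map length ?L)" unfolding L(2) by simp
    then have nonempty: "[] \<notin> set ?L" by (metis in_set_conv_nth length_map list.size(3) nth_map)
    then have "distinct ?L"
      using L(1) unfolding distinct_concat_iff by (metis removeAll_id)
    have i: "?L ! i \<in> set ?L" and j: "?L ! j \<in> set ?L"
      using ij length_reps by (simp_all only: nth_mem length_map lessThan_iff)
    have "set (?L ! i) = set (?L ! j)"
      using ij plane_key_rep_orbit length_reps by (metis lessThan_iff nth_map)
    moreover have "set (?L ! i) \<noteq> {}" using nonempty i by (metis set_empty)
    ultimately have "?L ! i = ?L ! j"
      using L(1) i j unfolding distinct_concat_iff by (metis Int_absorb)
    then show "i = j"
      using \<open>distinct ?L\<close> ij length_reps
      by (simp only: nth_eq_iff_index_eq length_map lessThan_iff)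
  qed
next
  show "rep_orbit ` {..<7} = monomial_orbit ` planes"
  proof (intro equalityI subsetI)
    fix X assume "X \<in> monomial_orbit ` planes"
    then obtain W where W: "W \<in> planes" "X = monomial_orbit W" by blast
    then have "plane_key W \<in> set (concat (map orbit_keys reps))" using keys_of_planes by blast
    then obtain i where i: "i < 7" "plane_key W \<in> set (orbit_keys (reps ! i))"
      using length_reps by (auto simp: in_set_conv_nth[of _ reps])
    then obtain W' where W': "W' \<in> rep_orbit i" "plane_key W = plane_key W'"
      using plane_key_rep_orbit by blast
    moreover have "W' \<in> planes"
      using W'(1) monomial_orbit_subset_planes[OF rep_in_planes[OF i(1)]]
      by (auto simp: rep_orbit_def)
    ultimately have "W \<in> rep_orbit i" using inj_on_plane_key W(1) by (metis inj_onD)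
    then have "X = rep_orbit i"
      unfolding W(2) rep_orbit_def by (rule monomial_orbit_eq)
    then show "X \<in> rep_orbit ` {..<7}" using i(1) by blast
  qed (auto simp: rep_orbit_def rep_in_planes)
qed

subsection \<open>Subgroups of an elementary abelian group of order 81\<close>

lemma f3_numerals: "(2 :: f3) = Z2" "(3 :: f3) = 0"
  unfolding numeral.simps one_f3_def zero_f3_def by simp_all

lemma of_int_f3_mod: "of_int (i mod 3) = (of_int i :: f3)"
proof -
  have "of_int (3 * (i div 3)) = (0 :: f3)" by (simp add: f3_numerals)
  then show ?thesis
    by (metis add_0 mult_div_mod_eq of_int_add)
qed

lemma bij_betw_of_int_f3: "bij_betw (of_int :: int \<Rightarrow> f3) {0..<3} UNIV"
proof -
  have "{0..<3} = {0, 1, 2 :: int}" by auto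
  then show ?thesis
    by (auto simp: bij_betw_def UNIV_f3 f3_numerals zero_f3_def one_f3_def)
qed

text \<open>All that the count needs to know of the linear maps: a copy of F_3^4 on which
  conjugation induces monomial maps only, and all of them. The relation is written without
  inverses.\<close>

locale monomial_conjugation = group G for G (structure) +
  fixes E :: "vec \<Rightarrow> 'a"
  assumes E_closed: "E x \<in> carrier G"
    and E_add: "E (\<lambda>h. x h + y h) = E x \<otimes> E y"
    and inj_E: "inj E"
    and conj_monomial: "g \<in> carrier G \<Longrightarrow> \<exists>M\<in>monomials. \<forall>x. g \<otimes> E x = E (M x) \<otimes> g"
    and monomial_conj: "M \<in> monomials \<Longrightarrow> \<exists>g\<in>carrier G. \<forall>x. g \<otimes> E x = E (M x) \<otimes> g"
begin

abbreviation A where "A \<equiv> G\<lparr>carrier := range E\<rparr>"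

lemma E_zero: "E (\<lambda>h. 0) = \<one>"
  using E_add[of "\<lambda>h. 0" "\<lambda>h. 0"] E_closed by (simp add: r_cancel_one)

lemma inv_E: "inv (E x) = E (\<lambda>h. - x h)"
  using E_add[of "\<lambda>h. - x h" x] by (intro inv_equality) (simp_all add: E_zero E_closed)

lemma subgroup_range_E: "subgroup (range E) G"
  by (rule subgroupI) (auto simp: E_closed inv_E E_add[symmetric])

lemma group_A: "group A"
  using subgroup_range_E by (rule subgroup_imp_group)

lemma subgroup_image_plane: "subgroup (E ` plane u v) A"
proof (rule group.subgroupI[OF group_A])
  show "E ` plane u v \<noteq> {}" using generators_in_plane by blast
  fix p q assume "p \<in> E ` plane u v" and "q \<in> E ` plane u v"
  then obtain i j k l where p: "p = E (comb i j u v)" and q: "q = E (comb k l u v)"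
    by (auto simp: plane_def)
  have "inv\<^bsub>A\<^esub> p = E (comb (- i) (- j) u v)"
    by (simp add: p group.m_inv_consistent subgroup_range_E inv_E) (simp add: comb_def algebra_simps)
  then show "inv\<^bsub>A\<^esub> p \<in> E ` plane u v" by (auto simp: plane_def)
  have "p \<otimes> q = E (comb (i + k) (j + l) u v)"
    by (simp add: p q E_add[symmetric] comb_def algebra_simps)
  then show "p \<otimes>\<^bsub>A\<^esub> q \<in> E ` plane u v" by (auto simp: plane_def)
qed auto

lemma image_plane_iso:
  assumes "indep u v"
  shows "A\<lparr>carrier := E ` plane u v\<rparr> \<cong> integer_mod_group 3 \<times>\<times> integer_mod_group 3"
proof -
  define e where "e = (\<lambda>(i, j). E (comb i j u v))"
  \<comment> \<open>\<open>of_int\<close> identifies the residues 0, 1, 2 with \<open>f3\<close>, so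
    \<open>f\<close> sends a pair of residues to the element with these coordinates in the basis
    \<open>u\<close>, \<open>v\<close>.\<close>
  define f :: "int \<times> int \<Rightarrow> 'a" where "f = e \<circ> map_prod of_int of_int"
  have "bij_betw e UNIV (E ` plane u v)"
    by (auto simp: e_def bij_betw_def inj_on_def inj_eq[OF inj_E] comb_eq_iff[OF assms] plane_def)
  moreover have "bij_betw (map_prod of_int of_int) ({0..<3} \<times> {0..<3}) (UNIV :: (f3 \<times> f3) set)"
    using bij_betw_map_prod[OF bij_betw_of_int_f3 bij_betw_of_int_f3] by simp
  ultimately have bij: "bij_betw f ({0..<3} \<times> {0..<3}) (E ` plane u v)"
    unfolding f_def by (rule bij_betw_trans[rotated])
  have "f ((i + k) mod 3, (j + l) mod 3) = f (i, j) \<otimes> f (k, l)" for i j k l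
    unfolding f_def e_def o_def map_prod_simp case_prod_conv of_int_f3_mod of_int_add
      E_add[symmetric]
    by (rule arg_cong[of _ _ E]) (simp add: comb_def algebra_simps)
  then have "f \<in> hom (integer_mod_group 3 \<times>\<times> integer_mod_group 3) (A\<lparr>carrier := E ` plane u v\<rparr>)"
    using bij_betwE[OF bij] by (intro homI) (auto simp: carrier_integer_mod_group)
  then have "f \<in> iso (integer_mod_group 3 \<times>\<times> integer_mod_group 3) (A\<lparr>carrier := E ` plane u v\<rparr>)"
    using bij by (simp add: isoI carrier_integer_mod_group)
  then have "integer_mod_group 3 \<times>\<times> integer_mod_group 3 \<cong> A\<lparr>carrier := E ` plane u v\<rparr>"
    by (rule is_isoI)
  then show ?thesis
    by (rule group.iso_sym[OF DirProd_group[OF group_integer_mod_group group_integer_mod_group]])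
qed

text \<open>A subgroup of order 9 pulls back to a set \<open>W\<close> of nine vectors closed under
  addition, hence a subspace. A nonzero \<open>u\<close> and a \<open>v\<close> outside its three
  multiples span nine vectors, thus all of \<open>W\<close>.\<close>

lemma subgroups_Z3_Z3_eq: "subgroups_Z3_Z3 A = (`) E ` planes"
proof (intro equalityI subsetI)
  fix H assume "H \<in> (`) E ` planes"
  then show "H \<in> subgroups_Z3_Z3 A"
    unfolding planes_def subgroups_Z3_Z3_def using subgroup_image_plane image_plane_iso by blast
next
  fix H assume "H \<in> subgroups_Z3_Z3 A"
  then have H: "subgroup H A" "A\<lparr>carrier := H\<rparr> \<cong> integer_mod_group 3 \<times>\<times> integer_mod_group 3"
    by (auto simp: subgroups_Z3_Z3_def)
  have sub: "H \<subseteq> range E" using subgroup.subset[OF H(1)] by simp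
  define W where "W = E -` H"
  have HW: "H = E ` W" using sub by (auto simp: W_def)
  have "card H = 9"
    using H(2) by (auto simp: is_iso_def iso_def carrier_integer_mod_group dest: bij_betw_same_card)
  then have card_W: "card W = 9"
    unfolding HW by (metis card_image inj_E inj_on_subset subset_UNIV)
  have add: "(\<lambda>h. x h + y h) \<in> W" if "x \<in> W" "y \<in> W" for x y
    using subgroup.m_closed[OF H(1)] that by (simp add: W_def E_add)
  have zero: "(\<lambda>h. 0) \<in> W"
    using subgroup.one_closed[OF H(1)] by (simp add: W_def E_zero)
  \<comment> \<open>The scalar 2 is handled by adding \<open>x\<close> to itself.\<close>
  have scale: "(\<lambda>h. i * x h) \<in> W" if "x \<in> W" for i x
    using that zero add[OF that that] by (cases i) (simp_all flip: zero_f3_def)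
  have "\<not> W \<subseteq> {\<lambda>h. 0}"
    using card_mono[of "{\<lambda>h. 0 :: f3}" W] card_W by auto
  then obtain u where u: "u \<in> W" "u \<noteq> (\<lambda>h. 0)" by blast
  have "card (range (\<lambda>j h. j * u h)) \<le> card (UNIV :: f3 set)" by (simp add: card_image_le)
  then have "card (range (\<lambda>j h. j * u h)) < card W" by (simp add: UNIV_f3 card_W)
  then have "\<not> W \<subseteq> range (\<lambda>j h. j * u h)" by (meson card_mono finite finite_imageI not_le)
  then obtain v where v: "v \<in> W" "v \<notin> range (\<lambda>j h. j * u h)" by blast
  have indep: "indep u v" using dependentD u(2) v(2) by blast
  have "plane u v \<subseteq> W"
    using add[OF scale[OF u(1)] scale[OF v(1)]] by (auto simp: plane_def comb_def)
  then have "plane u v = W"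
    using card_W card_plane[OF indep] by (intro card_subset_eq) (auto intro: card_ge_0_finite)
  then show "H \<in> (`) E ` planes" using HW indep by (auto simp: planes_def)
qed

lemma conj_set_image:
  assumes "g \<in> carrier G" and "\<And>x. g \<otimes> E x = E (M x) \<otimes> g"
  shows "conj_set G g (E ` W) = E ` M ` W"
proof -
  have "g \<otimes> E x \<otimes> inv g = E (M x)" for x
    using assms E_closed by (simp add: m_assoc)
  moreover have "conj_set G g H = (\<lambda>y. g \<otimes> y \<otimes> inv g) ` H" for H
    by (auto simp: conj_set_def l_coset_def r_coset_def)
  ultimately show ?thesis by (simp add: image_image)
qed

lemma orbit_image: "orbit G (conj_set G) (E ` W) = (`) E ` monomial_orbit W"
proof (intro equalityI subsetI)
  fix X assume "X \<in> orbit G (conj_set G) (E ` W)"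
  then obtain g where g: "g \<in> carrier G" "X = conj_set G g (E ` W)" by (auto simp: orbit_def)
  then obtain M where "M \<in> monomials" "X = E ` M ` W"
    using conj_monomial conj_set_image by metis
  then show "X \<in> (`) E ` monomial_orbit W" by (auto simp: monomial_orbit_def)
next
  fix X assume "X \<in> (`) E ` monomial_orbit W"
  then obtain M where "M \<in> monomials" "X = E ` M ` W" by (auto simp: monomial_orbit_def)
  then obtain g where "g \<in> carrier G" "X = conj_set G g (E ` W)"
    using monomial_conj conj_set_image by metis
  then show "X \<in> orbit G (conj_set G) (E ` W)" by (auto simp: orbit_def)
qed

lemma orbits_eq:
  "orbits G (subgroups_Z3_Z3 A) (conj_set G) = (`) ((`) E) ` monomial_orbit ` planes"
  unfolding subgroups_Z3_Z3_eq orbits_def by (simp add: orbit_image image_image Setcompr_eq_image)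

theorem conjugacy_classes:
  "card (subgroups_Z3_Z3 A) = 130 \<and>
    (\<exists>K. bij_betw K {1..7 :: nat} (orbits G (subgroups_Z3_Z3 A) (conj_set G)) \<and>
       card (K 1) = 6 \<and> card (K 2) = 24 \<and> card (K 3) = 16 \<and> card (K 4) = 12 \<and>
       card (K 5) = 16 \<and> card (K 6) = 48 \<and> card (K 7) = 8)"
proof -
  have inj1: "inj ((`) E)" using inj_E by (simp add: inj_image_eq_iff inj_def)
  then have inj2: "inj ((`) ((`) E))" by (simp add: inj_image_eq_iff inj_def)
  \<comment> \<open>The classes are numbered from 1, the representatives from 0.\<close>
  define K where "K = (\<lambda>i. (`) E ` rep_orbit (i - 1))"
  have "bij_betw (\<lambda>i :: nat. i - 1) {1..7} {..<7}"
    by (rule bij_betw_byWitness[where f' = Suc]) auto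
  moreover have "bij_betw (\<lambda>i. (`) E ` rep_orbit i) {..<7} ((`) ((`) E) ` monomial_orbit ` planes)"
    using bij_betw_trans[OF bij_betw_rep_orbit inj_on_imp_bij_betw[OF inj_on_subset[OF inj2 subset_UNIV]]]
    by (simp add: o_def)
  ultimately have "bij_betw K {1..7} (orbits G (subgroups_Z3_Z3 A) (conj_set G))"
    unfolding K_def orbits_eq using bij_betw_trans by (fastforce simp: o_def)
  moreover have "card (K i) = [6, 24, 16, 12, 16, 48, 8] ! (i - 1)" if "i - 1 < 7" for i
    using card_image[OF inj_on_subset[OF inj1 subset_UNIV]] card_rep_orbit[OF that]
    by (simp add: K_def)
  moreover have "card (subgroups_Z3_Z3 A) = 130"
    using card_image[OF inj_on_subset[OF inj1 subset_UNIV]] card_planes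
    by (simp add: subgroups_Z3_Z3_eq)
  ultimately show ?thesis by (intro conjI exI[of _ K]) (simp_all add: numeral_eq_Suc)
qed

end

subsection \<open>The stabilizer of the four planes\<close>

text \<open>Powers with exponent in \<open>f3\<close>; they add correctly when \<open>f\<close> has
  cube \<open>id\<close>.\<close>

fun act :: "f3 \<Rightarrow> ('v \<Rightarrow> 'v) \<Rightarrow> 'v \<Rightarrow> 'v" where
  "act Z0 f = id"
| "act Z1 f = f"
| "act Z2 f = f \<circ> f"

lemma additive_id: "additive id"
  by unfold_locales simp

lemma additive_comp: "additive f \<Longrightarrow> additive g \<Longrightarrow> additive (f \<circ> g)"
  by (simp add: additive_def)

lemma additive_act: "additive f \<Longrightarrow> additive (act i f)"
  by (cases i) (simp_all add: additive_comp additive_id)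

text \<open>Each \<open>V h\<close> is a line over F_4 with basis vector \<open>w h\<close>, and
  \<open>\<zeta> h\<close> multiplies it by an element \<omega> with \<omega>^2 = 1 + \<omega>.
  Linear maps appear as additive ones, which is the same over two elements.\<close>

locale omega_planes =
  fixes V :: "part \<Rightarrow> 'v::ab_group_add set" and \<zeta> :: "part \<Rightarrow> 'v \<Rightarrow> 'v" and w :: "part \<Rightarrow> 'v"
    and G :: "('v \<Rightarrow> 'v) monoid"
  assumes decomposition: "\<exists>!u. (\<forall>h. u h \<in> V h) \<and> v = (\<Sum>h\<in>UNIV. u h)"
    and char2: "v + v = (0 :: 'v)"
    and V_eq: "V h = {0, w h, \<zeta> h (w h), w h + \<zeta> h (w h)}"
    and w_nonzero: "w h \<noteq> 0" and \<zeta>w_nonzero: "\<zeta> h (w h) \<noteq> 0" and \<zeta>w_neq: "\<zeta> h (w h) \<noteq> w h"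
    and \<zeta>\<zeta>w: "\<zeta> h (\<zeta> h (w h)) = w h + \<zeta> h (w h)"
    and \<zeta>_cube: "\<zeta> h (\<zeta> h (\<zeta> h v)) = v"
    and \<zeta>_fix: "v \<in> V k \<Longrightarrow> k \<noteq> h \<Longrightarrow> \<zeta> h v = v"
    and \<zeta>_closed: "\<zeta> h \<in> carrier G"
    and group_G: "group G"
    and carrier_G: "carrier G = {g. additive g \<and> bij g \<and> (`) g ` range V = range V}"
    and mult_G: "x \<otimes>\<^bsub>G\<^esub> y = x \<circ> y"
    and one_G: "\<one>\<^bsub>G\<^esub> = id"
begin

lemma char2': "v + (v + x) = (x :: 'v)"
  by (simp add: char2 flip: add.assoc)

lemmas two_group_simps = add.assoc add.commute add.left_commute char2 char2'

lemma sum_eq_0_iff: "x + y = 0 \<longleftrightarrow> x = (y :: 'v)"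
  by (metis add.assoc add_0 char2)

lemma \<zeta>_additive: "additive (\<zeta> h)"
  using \<zeta>_closed carrier_G by simp

lemmas \<zeta>_add = additive.add[OF \<zeta>_additive]
lemmas \<zeta>_zero = additive.zero[OF \<zeta>_additive]

lemma additive_ext:
  assumes "additive f" "additive g" "\<And>h v. v \<in> V h \<Longrightarrow> f v = g v"
  shows "f = g"
proof
  fix v
  obtain u where u: "\<And>h. u h \<in> V h" "v = (\<Sum>h\<in>UNIV. u h)" using decomposition by blast
  have "(\<Sum>h\<in>UNIV. f (u h)) = (\<Sum>h\<in>UNIV. g (u h))"
    by (intro sum.cong refl assms(3)[OF u(1)])
  then show "f v = g v"
    by (simp only: u(2) additive.sum[OF assms(1)] additive.sum[OF assms(2)])
qed

lemma zero_in_V: "0 \<in> V h" and w_in_V: "w h \<in> V h"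
  by (simp_all add: V_eq)

lemma V_add: "x \<in> V h \<Longrightarrow> y \<in> V h \<Longrightarrow> x + y \<in> V h"
  by (auto simp: V_eq two_group_simps)

lemma \<zeta>_in_V: "v \<in> V h \<Longrightarrow> \<zeta> h v \<in> V h"
  by (auto simp: V_eq \<zeta>_add \<zeta>_zero \<zeta>\<zeta>w two_group_simps)

lemma act_in_V: "v \<in> V h \<Longrightarrow> act i (\<zeta> h) v \<in> V h"
  by (cases i) (simp_all add: \<zeta>_in_V)

lemma act_fix: "v \<in> V k \<Longrightarrow> k \<noteq> h \<Longrightarrow> act i (\<zeta> h) v = v"
  by (cases i) (simp_all add: \<zeta>_fix)

lemma decomposition_unique:
  assumes "\<And>h. u h \<in> V h" "\<And>h. u' h \<in> V h" "(\<Sum>h\<in>UNIV. u h) = (\<Sum>h\<in>UNIV. u' h)"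
  shows "u = u'"
  using decomposition[of "\<Sum>h\<in>UNIV. u h"] assms by metis

lemma V_disjoint:
  assumes "v \<in> V h" "v \<in> V k" "h \<noteq> k"
  shows "v = 0"
proof -
  \<comment> \<open>Placing \<open>v\<close> in summand \<open>h\<close> or in summand
    \<open>k\<close> gives two decompositions of the same vector.\<close>
  let ?u = "\<lambda>h i. if i = h then v else 0"
  have "?u h = ?u k"
    using assms(1,2) zero_in_V by (intro decomposition_unique) (simp_all add: sum.delta)
  then show ?thesis using assms(3) by metis
qed

lemma V_inj: "V h = V k \<Longrightarrow> h = k"
  using V_disjoint w_in_V w_nonzero by blast

text \<open>Any nonzero vector of a line over F_4 can serve as its basis in place of
  \<open>w h\<close>.\<close>

lemma generated_by_nonzero:
  assumes "z \<in> V h" "z \<noteq> 0"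
  shows "V h = {0, z, \<zeta> h z, z + \<zeta> h z}" "\<zeta> h (\<zeta> h z) = z + \<zeta> h z"
  using assms by (auto simp: V_eq \<zeta>_add \<zeta>_zero \<zeta>\<zeta>w two_group_simps)

definition E :: "vec \<Rightarrow> 'v \<Rightarrow> 'v" where
  "E x = act (x part.a) (\<zeta> part.a) \<circ> act (x part.b) (\<zeta> part.b)
    \<circ> act (x part.c) (\<zeta> part.c) \<circ> act (x part.d) (\<zeta> part.d)"

text \<open>The factors with index other than \<open>h\<close> fix \<open>V h\<close>
  pointwise.\<close>

lemma E_on_V: "v \<in> V h \<Longrightarrow> E x v = act (x h) (\<zeta> h) v"
  by (cases h) (simp_all add: E_def act_fix act_fix[OF act_in_V])

lemma E_additive: "additive (E x)"
  unfolding E_def by (intro additive_comp additive_act \<zeta>_additive)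

lemma act_add: "act (i + j) (\<zeta> h) = act i (\<zeta> h) \<circ> act j (\<zeta> h)"
  by (cases i; cases j) (simp_all add: fun_eq_iff \<zeta>_cube)

lemma E_add: "E (\<lambda>h. x h + y h) = E x \<circ> E y"
  by (rule additive_ext) (simp_all add: E_additive additive_comp E_on_V E_on_V[OF act_in_V] act_add)

lemma inj_E: "inj E"
proof (rule injI)
  fix x y assume "E x = E y"
  then have eq: "act (x h) (\<zeta> h) (w h) = act (y h) (\<zeta> h) (w h)" for h
    using E_on_V[OF w_in_V] by metis
  \<comment> \<open>The powers of \<omega> send \<open>w h\<close> to three different vectors, so
    the exponent can be read off.\<close>
  have "act i (\<zeta> h) (w h) = act j (\<zeta> h) (w h) \<longleftrightarrow> i = j" for h i j
    by (cases i; cases j)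
      (simp_all add: \<zeta>\<zeta>w w_nonzero \<zeta>w_nonzero \<zeta>w_neq \<zeta>w_neq[symmetric])
  then have "x h = y h" for h using eq by blast
  then show "x = y" by blast
qed

lemma act_closed: "act i (\<zeta> h) \<in> carrier G"
  using group.is_monoid[OF group_G] \<zeta>_closed[of h]
  by (cases i) (auto simp: mult_G[symmetric] one_G[symmetric] monoid.m_closed monoid.one_closed)

lemma E_closed: "E x \<in> carrier G"
  unfolding E_def mult_G[symmetric]
  using group.is_monoid[OF group_G] act_closed by (simp add: monoid.m_closed)

text \<open>Conjugation by \<open>g\<close> turns \<open>\<zeta> h\<close> into the power of
  \<open>\<zeta> (\<pi> h)\<close> with exponent \<open>t h\<close>; so place \<open>\<pi> h\<close>
  receives \<open>t h\<close> times the exponent at \<open>h\<close>. Agreement on the four summands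
  suffices.\<close>

lemma conj_monomialI:
  assumes g: "additive g" and \<pi>: "bij \<pi>"
    and gV: "\<And>h v. v \<in> V h \<Longrightarrow> g v \<in> V (\<pi> h)"
    and semi: "\<And>h v. v \<in> V h \<Longrightarrow> g (\<zeta> h v) = act (t h) (\<zeta> (\<pi> h)) (g v)"
    and nz: "\<And>h. t h \<noteq> 0"
  shows "g \<circ> E x = E (monomial (inv_into UNIV \<pi>) (\<lambda>k. t (inv_into UNIV \<pi> k)) x) \<circ> g"
proof (rule additive_ext)
  fix h v assume v: "v \<in> V h"
  have "g (act i (\<zeta> h) v) = act (t h * i) (\<zeta> (\<pi> h)) (g v)" for i
    using nz[of h] semi[OF v] semi[OF \<zeta>_in_V[OF v]]
    by (cases i; cases "t h") (simp_all add: zero_f3_def \<zeta>_cube)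
  moreover have "inv_into UNIV \<pi> (\<pi> h) = h" using \<pi> by (simp add: bij_is_inj)
  ultimately show "(g \<circ> E x) v
      = (E (monomial (inv_into UNIV \<pi>) (\<lambda>k. t (inv_into UNIV \<pi> k)) x) \<circ> g) v"
    by (simp add: E_on_V[OF v] E_on_V[OF gV[OF v]] monomial_def)
qed (intro additive_comp g E_additive)+

text \<open>\<open>GL(2,2)\<close> consists of semilinear maps of the field with four elements.\<close>

lemma semilinear_on_V:
  assumes g: "additive g" "inj g" and gV: "\<And>v. v \<in> V h \<Longrightarrow> g v \<in> V k"
  shows "\<exists>i. i \<noteq> 0 \<and> (\<forall>v\<in>V h. g (\<zeta> h v) = act i (\<zeta> k) (g v))"
proof -
  define z where "z = g (w h)"
  have g0: "g 0 = 0" by (rule additive.zero[OF g(1)])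
  have g_eq: "g x = g y \<longleftrightarrow> x = y" for x y using g(2) by (rule inj_eq)
  have z: "z \<in> V k" "z \<noteq> 0"
    using gV[OF w_in_V] w_nonzero g_eq[of _ 0] g0 by (simp_all add: z_def)
  note gen = generated_by_nonzero[OF z]
  have "g (\<zeta> h (w h)) \<in> V k" "g (\<zeta> h (w h)) \<noteq> 0" "g (\<zeta> h (w h)) \<noteq> z"
    using gV[OF \<zeta>_in_V[OF w_in_V]] g_eq[of _ 0]
    by (simp_all add: z_def g0 g_eq \<zeta>w_nonzero \<zeta>w_neq)
  \<comment> \<open>Either \<open>g\<close> is linear over F_4 on \<open>V h\<close>, or it is
    composed with the Frobenius map, which replaces \<omega> by its square.\<close>
  then consider "g (\<zeta> h (w h)) = \<zeta> k z" | "g (\<zeta> h (w h)) = z + \<zeta> k z"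
    using gen(1) by auto
  then show ?thesis
  proof cases
    case 1
    then have "\<forall>v\<in>V h. g (\<zeta> h v) = act Z1 (\<zeta> k) (g v)"
      by (auto simp: V_eq \<zeta>_add \<zeta>_zero \<zeta>\<zeta>w gen(2) g0 additive.add[OF g(1)] z_def[symmetric]
          two_group_simps)
    then show ?thesis by (metis f3.distinct(1) zero_f3_def)
  next
    case 2
    then have "\<forall>v\<in>V h. g (\<zeta> h v) = act Z2 (\<zeta> k) (g v)"
      by (auto simp: V_eq \<zeta>_add \<zeta>_zero \<zeta>\<zeta>w gen(2) g0 additive.add[OF g(1)] z_def[symmetric]
          two_group_simps)
    then show ?thesis by (metis f3.distinct(3) zero_f3_def)
  qed
qed

lemma conj_monomial:
  assumes "g \<in> carrier G"
  shows "\<exists>M\<in>monomials. \<forall>x. g \<circ> E x = E (M x) \<circ> g"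
proof -
  have g: "additive g" "bij g" "(`) g ` range V = range V"
    using assms carrier_G by simp_all
  have "g ` V h \<in> range V" for h by (subst g(3)[symmetric]) simp
  then have "\<forall>h. \<exists>k. g ` V h = V k" by (meson rangeE)
  from choice[OF this] obtain \<pi> where \<pi>: "\<And>h. g ` V h = V (\<pi> h)" by blast
  have "inj \<pi>"
  proof (rule injI)
    fix h k assume "\<pi> h = \<pi> k"
    then have "g ` V h = g ` V k" by (simp only: \<pi>)
    then show "h = k"
      unfolding inj_image_eq_iff[OF bij_is_inj[OF g(2)]] by (rule V_inj)
  qed
  then have bij: "bij \<pi>" by (simp add: bij_def finite_UNIV_inj_surj)
  have gV: "g v \<in> V (\<pi> h)" if "v \<in> V h" for h v using \<pi> that by blast
  have "\<forall>h. \<exists>i. i \<noteq> 0 \<and> (\<forall>v\<in>V h. g (\<zeta> h v) = act i (\<zeta> (\<pi> h)) (g v))"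
    by (intro allI semilinear_on_V[OF g(1) bij_is_inj[OF g(2)] gV])
  from choice[OF this] obtain t where t: "\<And>h. t h \<noteq> 0" "\<And>h v. v \<in> V h \<Longrightarrow> g (\<zeta> h v) = act (t h) (\<zeta> (\<pi> h)) (g v)"
    by blast
  let ?M = "monomial (inv_into UNIV \<pi>) (\<lambda>k. t (inv_into UNIV \<pi> k))"
  have "?M \<in> monomials"
    unfolding monomials_def using bij_imp_bij_inv[OF bij] t(1) by blast
  moreover have "\<forall>x. g \<circ> E x = E (?M x) \<circ> g"
    using conj_monomialI[OF g(1) bij gV t(2,1)] by blast
  ultimately show ?thesis by blast
qed

text \<open>Prescribe the map on each four-element summand by a table and extend it through the
  components of a vector.\<close>

lemma ex_additive_on_basis:
  fixes p q p' q' :: "part \<Rightarrow> 'v"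
  assumes V: "\<And>h. V h = {0, p h, q h, p h + q h}"
    and nz: "\<And>h. p h \<noteq> 0" "\<And>h. q h \<noteq> 0" "\<And>h. p h \<noteq> q h"
  shows "\<exists>g. additive g \<and> (\<forall>h. g (p h) = p' h \<and> g (q h) = q' h)"
proof -
  define f where "f = (\<lambda>h v. if v = 0 then 0 else if v = p h then p' h else if v = q h then q' h
    else p' h + q' h)"
  have pq: "p h + q h \<noteq> 0" "p h + q h \<noteq> p h" "p h + q h \<noteq> q h" for h
    using nz[of h] by (simp_all add: sum_eq_0_iff)
  have f_add: "f h (x + y) = f h x + f h y" if "x \<in> V h" "y \<in> V h" for h x y
    using that nz[of h] pq[of h] unfolding V f_def
    by (elim insertE emptyE; simp add: two_group_simps)
  \<comment> \<open>\<open>c v\<close> is the family of components of \<open>v\<close>; uniqueness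
    of the decomposition makes it additive in \<open>v\<close>.\<close>
  define c where "c = (\<lambda>v. THE u. (\<forall>h. u h \<in> V h) \<and> v = (\<Sum>h\<in>UNIV. u h))"
  have c: "c v h \<in> V h" "v = (\<Sum>h\<in>UNIV. c v h)" for v h
    using theI'[OF decomposition[of v]] unfolding c_def by blast+
  have c_eq: "c (\<Sum>h\<in>UNIV. u h) = u" if "\<And>h. u h \<in> V h" for u
    using that c by (intro decomposition_unique) auto
  have c_add: "c (x + y) = (\<lambda>h. c x h + c y h)" for x y
    using c_eq[of "\<lambda>h. c x h + c y h"] V_add c by (simp add: sum.distrib)
  define g where "g = (\<lambda>v. \<Sum>h\<in>UNIV. f h (c v h))"
  have "additive g"
    by unfold_locales (simp add: g_def c_add f_add c sum.distrib)
  moreover have gf: "g v = f h v" if "v \<in> V h" for h v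
  proof -
    have "c v = (\<lambda>k. if k = h then v else 0)"
      using c_eq[of "\<lambda>k. if k = h then v else 0"] that zero_in_V by (simp add: sum.delta)
    moreover have "f k 0 = 0" for k by (simp add: f_def)
    ultimately show ?thesis by (simp add: g_def if_distrib[of "f _"] sum.delta cong: if_cong)
  qed
  moreover have "g (p h) = p' h \<and> g (q h) = q' h" for h
    using nz[of h] gf[of "p h" h] gf[of "q h" h] by (simp add: V f_def)
  ultimately show ?thesis by blast
qed

text \<open>The required \<open>g\<close> sends the basis \<open>w h\<close>, \<omega>
  \<open>w h\<close> of \<open>V h\<close> to \<open>w\<close> and \<omega> or \<omega>^2 times
  \<open>w\<close> in the target summand; the square occurs exactly where the sign is -1.\<close>

lemma monomial_conj:
  assumes "M \<in> monomials"
  shows "\<exists>g\<in>carrier G. \<forall>x. g \<circ> E x = E (M x) \<circ> g"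
proof -
  obtain \<sigma> s where M: "M = monomial \<sigma> s" "bij \<sigma>" "\<And>h. s h \<noteq> 0"
    using assms by (auto simp: monomials_def)
  \<comment> \<open>\<open>monomial\<close> pulls coordinates back, so the summands move by the
    inverse permutation.\<close>
  define \<pi> where "\<pi> = inv_into UNIV \<sigma>"
  have \<pi>: "bij \<pi>" and \<sigma>\<pi>: "\<sigma> (\<pi> h) = h" and \<pi>\<sigma>: "\<pi> (\<sigma> h) = h" for h
    using M(2) by (simp_all add: \<pi>_def bij_imp_bij_inv bij_is_surj surj_f_inv_f bij_is_inj)
  define q where "q k = act (s k) (\<zeta> k) (w k)" for k
  have q: "q k = \<zeta> k (w k) \<and> s k = Z1 \<or> q k = w k + \<zeta> k (w k) \<and> s k = Z2" for k
    using M(3)[of k] by (cases "s k") (simp_all add: q_def \<zeta>\<zeta>w zero_f3_def)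
  have Vq: "V k = {0, w k, q k, w k + q k}" for k
    using q[of k] by (auto simp: V_eq two_group_simps)
  have q_nz: "q k \<noteq> 0" "w k \<noteq> q k" for k
    using q[of k]
    by (elim disjE conjE; simp add: w_nonzero \<zeta>w_nonzero \<zeta>w_neq \<zeta>w_neq[symmetric] sum_eq_0_iff)+
  obtain g where g: "additive g" "\<And>h. g (w h) = w (\<pi> h)" "\<And>h. g (\<zeta> h (w h)) = q (\<pi> h)"
    using ex_additive_on_basis[OF V_eq w_nonzero \<zeta>w_nonzero \<zeta>w_neq[symmetric],
        of "\<lambda>h. w (\<pi> h)" "\<lambda>h. q (\<pi> h)"]
    by blast
  \<comment> \<open>Interchanging the two bases yields the inverse map, and with it
    bijectivity.\<close>
  obtain g' where g': "additive g'" "\<And>h. g' (w h) = w (\<sigma> h)" "\<And>h. g' (q h) = \<zeta> (\<sigma> h) (w (\<sigma> h))"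
    using ex_additive_on_basis[OF Vq w_nonzero q_nz,
        of "\<lambda>h. w (\<sigma> h)" "\<lambda>h. \<zeta> (\<sigma> h) (w (\<sigma> h))"]
    by blast
  note add = additive.add[OF g(1)] additive.zero[OF g(1)]
    additive.add[OF g'(1)] additive.zero[OF g'(1)]
  have "g' \<circ> g = id"
    by (rule additive_ext)
      (auto simp: additive_comp additive_id g(1) g'(1) V_eq add g(2,3) g'(2,3) \<sigma>\<pi>)
  moreover have "g \<circ> g' = id"
    by (rule additive_ext)
      (auto simp: additive_comp additive_id g(1) g'(1) Vq add g(2,3) g'(2,3) \<pi>\<sigma>)
  ultimately have "bij g" using o_bij by blast
  have gV: "g ` V h = V (\<pi> h)" for h
    by (simp add: V_eq[of h] Vq[of "\<pi> h"] add g(2,3))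
  then have "(`) g ` range V = V ` range \<pi>" by (simp add: image_image)
  then have "(`) g ` range V = range V" using \<pi> by (simp add: bij_is_surj)
  then have "g \<in> carrier G" using carrier_G g(1) \<open>bij g\<close> by simp
  moreover have "g \<circ> E x = E (M x) \<circ> g" for x
  proof -
    have "g (\<zeta> h v) = act (s (\<pi> h)) (\<zeta> (\<pi> h)) (g v)" if "v \<in> V h" for h v
      using that q[of "\<pi> h"]
      by (auto simp: V_eq \<zeta>_add \<zeta>_zero \<zeta>\<zeta>w add g(2,3) two_group_simps)
    moreover have "g v \<in> V (\<pi> h)" if "v \<in> V h" for h v
      using that gV by blast
    ultimately have "g \<circ> E x = E (monomial (inv_into UNIV \<pi>)
        (\<lambda>k. s (\<pi> (inv_into UNIV \<pi> k))) x) \<circ> g"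
      by (intro conj_monomialI[OF g(1) \<pi>] M(3))
    moreover have "inv_into UNIV \<pi> = \<sigma>" unfolding \<pi>_def by (rule inv_inv_eq[OF M(2)])
    ultimately show ?thesis by (simp add: M(1) \<pi>\<sigma>)
  qed
  ultimately show ?thesis by blast
qed

sublocale monomial_conjugation G E
  by (intro monomial_conjugation.intro group_G monomial_conjugation_axioms.intro)
    (simp_all add: mult_G E_closed E_add inj_E conj_monomial monomial_conj)

end

section \<open>From vector spaces over F_2 to lines over F_4\<close>

lemma linear_bit_iff_additive:
  fixes scale :: "bit \<Rightarrow> 'v::ab_group_add \<Rightarrow> 'v"
  assumes "vector_space scale"
  shows "Vector_Spaces.linear scale scale f \<longleftrightarrow> additive f"
proof -
  interpret vector_space scale by fact
  have "f (scale r x) = scale r (f x)" if "additive f" for r x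
    using additive.zero[OF that] by (cases r) simp_all
  then show ?thesis
    using assms by (auto simp: Vector_Spaces.linear_iff additive_def)
qed

lemma two_dimensional_bit_space:
  fixes scale :: "bit \<Rightarrow> 'v::ab_group_add \<Rightarrow> 'v"
  assumes "vector_space scale" "module.subspace scale S" "vector_space.dim scale S = 2"
  shows "\<exists>p q. S = {0, p, q, p + q} \<and> p \<noteq> 0 \<and> q \<noteq> 0 \<and> p \<noteq> q"
proof -
  interpret vector_space scale by fact
  obtain B where B: "B \<subseteq> S" "independent B" "S \<subseteq> span B" "card B = 2"
    using basis_exists[of S] assms(3) by metis
  then obtain p q where pq: "B = {p, q}" "p \<noteq> q" by (meson card_2_iff)
  have S: "S = span {p, q}"
    using B(1,3) pq(1) assms(2) span_minimal by blast
  have ex_bit: "(\<exists>k. P k) \<longleftrightarrow> P 0 \<or> P 1" for P :: "bit \<Rightarrow> bool" by (metis bit_not_one_iff)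
  have "S = {0, p, q, p + q}"
    unfolding S span_insert span_empty by (auto simp: ex_bit algebra_simps)
  moreover have "p \<noteq> 0" "q \<noteq> 0" using B(2) pq(1) dependent_zero by blast+
  ultimately show ?thesis using pq(2) by blast
qed

lemma cyclic_group_3:
  assumes "group G" "G \<cong> integer_mod_group 3"
  shows "\<exists>z. z \<noteq> \<one>\<^bsub>G\<^esub> \<and> carrier G = {\<one>\<^bsub>G\<^esub>, z, z \<otimes>\<^bsub>G\<^esub> z} \<and> z \<otimes>\<^bsub>G\<^esub> (z \<otimes>\<^bsub>G\<^esub> z) = \<one>\<^bsub>G\<^esub>"
proof -
  obtain \<phi> where \<phi>: "\<phi> \<in> iso (integer_mod_group 3) G"
    using group.iso_sym[OF assms] by (auto simp: is_iso_def)
  have carr: "carrier (integer_mod_group 3) = {0, 1, 2}"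
    by (auto simp: carrier_integer_mod_group)
  have hom: "\<phi> ((x + y) mod 3) = \<phi> x \<otimes>\<^bsub>G\<^esub> \<phi> y" if "x \<in> {0, 1, 2}" "y \<in> {0, 1, 2}" for x y
    using \<phi> hom_mult[of \<phi> "integer_mod_group 3" G x y] that unfolding carr iso_def by simp
  have zero: "\<phi> 0 = \<one>\<^bsub>G\<^esub>"
    using \<phi> hom_one[of \<phi> "integer_mod_group 3" G] assms(1) by (simp add: iso_def)
  have "\<phi> 2 = \<phi> 1 \<otimes>\<^bsub>G\<^esub> \<phi> 1" "\<phi> 1 \<otimes>\<^bsub>G\<^esub> \<phi> 2 = \<one>\<^bsub>G\<^esub>"
    using hom[of 1 1] hom[of 1 2] zero by simp_all
  moreover have "bij_betw \<phi> {0, 1, 2} (carrier G)"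
    using \<phi> carr by (simp add: iso_def)
  then have "carrier G = {\<phi> 0, \<phi> 1, \<phi> 2}" "\<phi> 1 \<noteq> \<phi> 0"
    by (auto simp: bij_betw_def)
  ultimately show ?thesis using zero by (intro exI[of _ "\<phi> 1"]) simp
qed

lemma carrier_G_L4:
  fixes scale :: "bit \<Rightarrow> 'v::ab_group_add \<Rightarrow> 'v"
  assumes "vector_space scale"
  shows "carrier (G_L4 scale V) = {g. additive g \<and> bij g \<and> (`) g ` range V = range V}"
  by (auto simp: G_L4_def stabilizer_def GL_def linear_bit_iff_additive[OF assms])

lemma G_L4_simps: "x \<otimes>\<^bsub>G_L4 scale V\<^esub> y = x \<circ> y" "\<one>\<^bsub>G_L4 scale V\<^esub> = id"
  by (simp_all add: G_L4_def GL_def)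

lemma group_G_L4:
  fixes scale :: "bit \<Rightarrow> 'v::ab_group_add \<Rightarrow> 'v"
  assumes "vector_space scale"
  shows "group (G_L4 scale V)"
proof (rule groupI, unfold G_L4_simps carrier_G_L4[OF assms])
  fix f g assume f: "f \<in> {g. additive g \<and> bij g \<and> (`) g ` range V = range V}"
  { assume g: "g \<in> {g. additive g \<and> bij g \<and> (`) g ` range V = range V}"
    have "(`) (f \<circ> g) ` \<L> = (`) f ` (`) g ` \<L>" for \<L> by (simp add: image_image)
    then show "f \<circ> g \<in> {g. additive g \<and> bij g \<and> (`) g ` range V = range V}"
      using f g by (simp add: additive_comp bij_comp) }
  let ?i = "inv_into UNIV f"
  have fi: "f (?i x) = x" and inv_f: "?i (f x) = x" for x
    using f by (simp_all add: bij_is_surj surj_f_inv_f bij_is_inj)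
  have "additive ?i"
    using f by unfold_locales (metis (mono_tags) additive.add fi inv_f mem_Collect_eq)
  moreover have "(`) ?i ` (`) f ` range V = range V"
    by (simp add: image_image inv_f)
  then have "(`) ?i ` range V = range V" using f by simp
  ultimately show "\<exists>y\<in>{g. additive g \<and> bij g \<and> (`) g ` range V = range V}. y \<circ> f = id"
    using f by (intro bexI[of _ ?i]) (auto simp: bij_imp_bij_inv inv_f)
qed (auto simp: additive_id)

text \<open>A nontrivial map with cube \<open>id\<close> permutes the three nonzero vectors of
  \<open>S\<close> cyclically, and each of these is the sum of the other two.\<close>

lemma ex_omega:
  fixes z :: "'v::ab_group_add \<Rightarrow> 'v"
  assumes char2: "\<And>v :: 'v. v + v = 0"
    and S: "S = {0, p, q, p + q}" "p \<noteq> 0" "q \<noteq> 0" "p \<noteq> q"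
    and z: "additive z" "\<And>v. z (z (z v)) = v" "\<And>v. v \<in> S \<Longrightarrow> z v \<in> S"
    and nontrivial: "\<exists>v\<in>S. z v \<noteq> v"
  shows "S = {0, p, z p, p + z p}" "z p \<noteq> 0" "z p \<noteq> p" "z (z p) = p + z p"
proof -
  have char2': "v + (v + x) = x" for v x :: 'v by (simp add: char2 flip: add.assoc)
  note simps = add.assoc add.commute add.left_commute char2 char2'
  have z_eq: "z x = z y \<longleftrightarrow> x = y" for x y using z(2) by metis
  have z0: "z 0 = 0" by (rule additive.zero[OF z(1)])
  have sum: "p + q \<noteq> 0" "p + q \<noteq> p" "p + q \<noteq> q"
    using S(2-4) char2' by (metis add.right_neutral, auto)
  show zp0: "z p \<noteq> 0" using z_eq[of p 0] z0 S(2) by simp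
  show zp: "z p \<noteq> p"
  proof
    assume fix_p: "z p = p"
    have "z q \<in> {0, p, q, p + q}" using z(3) S(1) by blast
    moreover have "z q \<noteq> 0" "z q \<noteq> p" using z_eq[of q] z0 S fix_p by metis+
    ultimately have "z q = q \<or> z q = p + q" by blast
    \<comment> \<open>Were \<open>p\<close> fixed, \<open>z\<close> would fix or swap the other two
      nonzero vectors; either way its square fixes \<open>q\<close>, and so does \<open>z\<close>
      because its cube is \<open>id\<close>.\<close>
    then have "z (z q) = q"
      by (auto simp: additive.add[OF z(1)] fix_p char2')
    then have "z q = q" using z(2) by metis
    then have "\<forall>v\<in>S. z v = v" by (simp add: S(1) additive.add[OF z(1)] fix_p z0)
    then show False using nontrivial by blast
  qed
  have "z p \<in> {0, p, q, p + q}" using z(3) S(1) by blast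
  then have "z p = q \<or> z p = p + q" using zp zp0 by blast
  then show Szp: "S = {0, p, z p, p + z p}"
    using S(1) by (elim disjE) (auto simp: char2')
  have "z (z p) \<in> {0, p, z p, p + z p}" using z(3) Szp by blast
  moreover have "z (z p) \<noteq> 0" "z (z p) \<noteq> z p" "z (z p) \<noteq> p"
    using z_eq z0 zp zp0 z(2) by metis+
  ultimately show "z (z p) = p + z p" by blast
qed

theorem theorem5:
  fixes scale :: "bit \<Rightarrow> 'v::ab_group_add \<Rightarrow> 'v"
    and V :: "part \<Rightarrow> 'v set"
    and Z :: "part \<Rightarrow> ('v \<Rightarrow> 'v) set"
  assumes "vector_space scale"
    and "vector_space.dim scale (UNIV :: 'v set) = 8"
    and "direct_sum_decomposition scale V"
    and "\<forall>h. vector_space.dim scale (V h) = 2"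
    and "\<forall>h. is_Z scale V h (Z h)"
  shows "card (subgroups_Z3_Z3 (G81 scale V Z)) = 130 \<and>
    (\<exists>K :: nat \<Rightarrow> ('v \<Rightarrow> 'v) set set.
       bij_betw K {1..7}
         (orbits (G_L4 scale V) (subgroups_Z3_Z3 (G81 scale V Z)) (conj_set (G_L4 scale V))) \<and>
       card (K 1) = 6 \<and> card (K 2) = 24 \<and> card (K 3) = 16 \<and> card (K 4) = 12 \<and>
       card (K 5) = 16 \<and> card (K 6) = 48 \<and> card (K 7) = 8)"
proof -
  interpret vector_space scale by fact
  let ?G = "G_L4 scale V"
  have char2: "v + v = 0" for v :: 'v
    using scale_left_distrib[of 1 1 v] by simp
  have subsp: "subspace (V h)" for h
    using assms(3) by (simp add: direct_sum_decomposition_def)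
  have sum_part: "(\<Sum>h\<in>UNIV. u h) = u part.a + u part.b + u part.c + u part.d" for u :: "part \<Rightarrow> 'v"
    by (simp add: UNIV_part add.assoc)
  have decomp: "\<exists>!u. (\<forall>h. u h \<in> V h) \<and> v = (\<Sum>h\<in>UNIV. u h)" for v
    using assms(3) unfolding sum_part by (simp add: direct_sum_decomposition_def)
  have unique: "u = u'" if "\<And>h. u h \<in> V h" "\<And>h. u' h \<in> V h"
    "(\<Sum>h\<in>UNIV. u h) = (\<Sum>h\<in>UNIV. u' h)" for u u'
    using decomp[of "\<Sum>h\<in>UNIV. u h"] that by metis
  have "\<forall>h. \<exists>p q. V h = {0, p, q, p + q} \<and> p \<noteq> 0 \<and> q \<noteq> 0 \<and> p \<noteq> q"
    using two_dimensional_bit_space[OF assms(1) subsp] assms(4) by blast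
  then obtain w q where V: "\<And>h. V h = {0, w h, q h, w h + q h}"
    and nz: "\<And>h. w h \<noteq> 0" "\<And>h. q h \<noteq> 0" "\<And>h. w h \<noteq> q h"
    by metis
  have disjoint: "h = k" if "V h = V k" for h k
  proof (rule ccontr)
    assume "h \<noteq> k"
    let ?u = "\<lambda>h' i. if i = h' then w h else 0"
    have "w h \<in> V h" by (simp add: V)
    then have mem: "w h \<in> V h" "w h \<in> V k" "0 \<in> V i" for i
      using that by (simp_all add: subspace_0 subsp)
    have "?u h = ?u k"
      by (rule unique) (simp_all add: mem sum.delta)
    then show False using \<open>h \<noteq> k\<close> nz(1) by metis
  qed
  have "\<exists>z. z \<noteq> id \<and> Z h = {id, z, z \<circ> z} \<and> z \<circ> (z \<circ> z) = id" for h
  proof -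
    have "subgroup (Z h) ?G" and iso: "?G\<lparr>carrier := Z h\<rparr> \<cong> integer_mod_group 3"
      using assms(5) by (auto simp: is_Z_def)
    then have "group (?G\<lparr>carrier := Z h\<rparr>)"
      using group.subgroup_imp_group[OF group_G_L4[OF assms(1)]] by blast
    from cyclic_group_3[OF this iso] show ?thesis by (simp add: G_L4_simps)
  qed
  then have "\<forall>h. \<exists>z. z \<noteq> id \<and> Z h = {id, z, z \<circ> z} \<and> z \<circ> (z \<circ> z) = id" by blast
  from choice[OF this] obtain \<zeta> where \<zeta>: "\<And>h. \<zeta> h \<noteq> id" "\<And>h. Z h = {id, \<zeta> h, \<zeta> h \<circ> \<zeta> h}"
    "\<And>h. \<zeta> h \<circ> (\<zeta> h \<circ> \<zeta> h) = id" by blast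
  have \<zeta>_closed: "\<zeta> h \<in> carrier ?G" for h
    using assms(5) subgroup.subset[of "Z h" ?G] \<zeta>(2) by (auto simp: is_Z_def)
  have \<zeta>_fix: "\<zeta> h v = v" if "v \<in> V k" "k \<noteq> h" for h k v
    using assms(5) \<zeta>(2)[of h] that by (auto simp: is_Z_def)
  have cube: "\<zeta> h (\<zeta> h (\<zeta> h v)) = v" for h v
    using fun_cong[OF \<zeta>(3)[of h], of v] by simp
  have \<zeta>_additive: "additive (\<zeta> h)" and \<zeta>_inj: "inj (\<zeta> h)"
    and \<zeta>_range: "(`) (\<zeta> h) ` range V = range V" for h
    using \<zeta>_closed[of h] by (auto simp: carrier_G_L4[OF assms(1)] bij_is_inj)
  have \<zeta>_perm: "\<zeta> h ` V k \<in> range V" for h k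
    by (subst \<zeta>_range[of h, symmetric]) simp
  \<comment> \<open>Membership in the stabilizer alone would allow \<open>\<zeta> h\<close> to
    permute summands. But a summand \<open>V k\<close> with \<open>k\<close> different from
    \<open>h\<close> is already its own image, so injectivity keeps \<open>V h\<close> from being
    mapped onto it.\<close>
  have \<zeta>_V: "\<zeta> h v \<in> V h" if "v \<in> V h" for h v
  proof -
    obtain k where k: "\<zeta> h ` V h = V k" using \<zeta>_perm by blast
    have "k = h"
    proof (rule ccontr)
      assume "k \<noteq> h"
      then have "\<zeta> h ` V k = V k" using \<zeta>_fix by force
      then have "\<zeta> h ` V h = \<zeta> h ` V k" using k by simp
      then have "V h = V k" unfolding inj_image_eq_iff[OF \<zeta>_inj] .
      then show False using disjoint \<open>k \<noteq> h\<close> by blast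
    qed
    then show ?thesis using k that by blast
  qed
  \<comment> \<open>\<open>\<zeta> h\<close> is the identity on the other summands, so being
    different from \<open>id\<close> it must move a vector of \<open>V h\<close>.\<close>
  have nontrivial: "\<exists>v\<in>V h. \<zeta> h v \<noteq> v" for h
  proof (rule ccontr)
    assume "\<not> ?thesis"
    then have fix_V: "\<zeta> h v = v" if "v \<in> V k" for k v
      using that \<zeta>_fix[OF that, of h] by (cases "k = h") auto
    have "\<zeta> h v = v" for v
    proof -
      obtain u where u: "\<And>k. u k \<in> V k" "v = (\<Sum>k\<in>UNIV. u k)" using decomp by blast
      then show ?thesis by (simp add: additive.sum[OF \<zeta>_additive] fix_V[OF u(1)])
    qed
    then show False using \<zeta>(1)[of h] by (auto simp: fun_eq_iff)
  qed
  have omega: "V h = {0, w h, \<zeta> h (w h), w h + \<zeta> h (w h)}" "\<zeta> h (w h) \<noteq> 0"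
    "\<zeta> h (w h) \<noteq> w h" "\<zeta> h (\<zeta> h (w h)) = w h + \<zeta> h (w h)" for h
    by (rule ex_omega[OF char2 V[of h] nz[of h] \<zeta>_additive[of h] cube[of h] _ nontrivial[of h]],
        erule \<zeta>_V)+
  interpret omega_planes V \<zeta> w ?G
    by (rule omega_planes.intro)
      (fact decomp char2 omega nz(1) cube \<zeta>_fix \<zeta>_closed group_G_L4[OF assms(1)]
        carrier_G_L4[OF assms(1)] G_L4_simps)+
  have Z_eq: "Z h = range (\<lambda>i. act i (\<zeta> h))" for h
    by (simp add: \<zeta>(2) UNIV_f3)
  \<comment> \<open>The product of the four groups is parametrised by exponent vectors, which
    identifies \<open>G81\<close> with the group \<open>A\<close> of the locale.\<close>
  have "Z part.a <#>\<^bsub>?G\<^esub> Z part.b <#>\<^bsub>?G\<^esub> Z part.c <#>\<^bsub>?G\<^esub> Z part.d = range E"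
  proof (intro equalityI subsetI)
    fix g assume "g \<in> Z part.a <#>\<^bsub>?G\<^esub> Z part.b <#>\<^bsub>?G\<^esub> Z part.c <#>\<^bsub>?G\<^esub> Z part.d"
    then obtain i j k l where
      "g = act i (\<zeta> part.a) \<circ> act j (\<zeta> part.b) \<circ> act k (\<zeta> part.c) \<circ> act l (\<zeta> part.d)"
      unfolding Z_eq set_mult_def mult_G by blast
    then have "g = E (case_part i j k l)" by (simp add: E_def)
    then show "g \<in> range E" by blast
  next
    fix g assume "g \<in> range E"
    then obtain x where x: "g = E x" by blast
    have comp: "f \<circ> f' \<in> P <#>\<^bsub>?G\<^esub> Q" if "f \<in> P" "f' \<in> Q" for f f' P Q
      using that unfolding set_mult_def mult_G by blast
    show "g \<in> Z part.a <#>\<^bsub>?G\<^esub> Z part.b <#>\<^bsub>?G\<^esub> Z part.c <#>\<^bsub>?G\<^esub> Z part.d"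
      unfolding x E_def Z_eq by (intro comp rangeI)
  qed
  then have "G81 scale V Z = A" by (simp add: G81_def Let_def)
  then show ?thesis using conjugacy_classes by simp
qed

end
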